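(* Let $a,b$ be positive integers with $\gcd(a,b)=1$. Let $p$ be an odd prime such that $p\neq ab$, $p\neq ab+1$ and $p=x^2+aby^2$ with $x,y\in\mathbb{Z}$. Let $n=(a+b)(p-1)/8$. (i) If $2\nmid ab$, then $$(-1)^{\frac{ab+1}{2}y}(4x^2-2p)=\lambda(a,b;n+1)=\sum_{k_1+2k_2+\cdots+nk_n=n}(-3)^{k_1+\cdots+k_n}\frac{\left(a\sigma(\frac1a)+b\sigma(\frac1b)\right)^{k_1}\cdots\left(a\sigma(\frac na)+b\sigma(\frac nb)\right)^{k_n}}{1^{k_1}\cdot k_1!\cdots n^{k_n}\cdot k_n!}.$$ (ii) If $2\nmid a$, $2\mid b$, $8\nmid b$ and $8\mid p-1$, then $$(-1)^{\frac y2}(4x^2-2p)=\lambda(a,b;n+1)=\sum_{k_1+2k_2+\cdots+nk_n=n}(-3)^{k_1+\cdots+k_n}\frac{\left(a\sigma(\frac1a)+b\sigma(\frac1b)\right)^{k_1}\cdots\left(a\sigma(\frac na)+b\sigma(\frac nb)\right)^{k_n}}{1^{k_1}\cdot k_1!\cdots n^{k_n}\cdot k_n!}.$$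
   Context: For positive integers $a,b,n$, $\lambda(a,b;n)$ is the integer defined by the power series expansion $q\prod_{k=1}^{\infty}(1-q^{ak})^3(1-q^{bk})^3=\sum_{n=1}^{\infty}\lambda(a,b;n)q^n$ for $|q|<1$. For a rational number $m$, $\sigma(m)=\sum_{d\mid m}d$ (sum over positive divisors $d$ of $m$) if $m$ is a positive integer, and $\sigma(m)=0$ otherwise. The sums run over all $n$-tuples $(k_1,\ldots,k_n)$ of nonnegative integers with $k_1+2k_2+\cdots+nk_n=n$, with the convention $0^0=1$. *)

theory Defs
  imports "HOL-Complex_Analysis.Complex_Analysis"
begin

text \<open>
  \<open>lam a b n\<close> is $\lambda(a,b;n)$. The product is taken in the ring of formal power series over the
  integers; \<open>lam_product_has_prod\<close> shows that it converges there, and \<open>lam_sums\<close> that the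
  coefficients are those of the analytic expansion for \<open>norm q < 1\<close>.
\<close>

definition lam :: "nat \<Rightarrow> nat \<Rightarrow> nat \<Rightarrow> int" where
  "lam a b n = fps_nth (fps_X * (\<Prod>k. (1 - fps_X ^ (a * Suc k)) ^ 3 * (1 - fps_X ^ (b * Suc k)) ^ 3)) n"

definition sigma :: "rat \<Rightarrow> nat" where
  "sigma m = (if m \<in> \<int> \<and> m > 0 then \<Sum>{d. d dvd nat \<lfloor>m\<rfloor>} else 0)"

text \<open>
  Tuples \<open>(k 1, \<dots>, k n)\<close> are extensional functions on \<open>{1..n}\<close>, so that each tuple is counted once.
\<close>

definition weighted_tuples :: "nat \<Rightarrow> (nat \<Rightarrow> nat) set" where
  "weighted_tuples n = {k \<in> {1..n} \<rightarrow>\<^sub>E UNIV. (\<Sum>i=1..n. i * k i) = n}"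

definition sigma_sum :: "nat \<Rightarrow> nat \<Rightarrow> nat \<Rightarrow> rat" where
  "sigma_sum a b n =
     (\<Sum>k\<in>weighted_tuples n. (-3) ^ (\<Sum>i=1..n. k i) *
        ((\<Prod>i=1..n. (of_nat a * of_nat (sigma (of_nat i / of_nat a))
                    + of_nat b * of_nat (sigma (of_nat i / of_nat b))) ^ k i) /
         (\<Prod>i=1..n. of_nat i ^ k i * fact (k i))))"

lemma finite_weighted_tuples: "finite (weighted_tuples n)"
proof (rule finite_subset)
  show "weighted_tuples n \<subseteq> {1..n} \<rightarrow>\<^sub>E {..n}"
  proof
    fix k assume k: "k \<in> weighted_tuples n"
    have "k i \<le> n" if i: "i \<in> {1..n}" for i
    proof -
      have "k i \<le> i * k i" using i by simp
      also have "\<dots> \<le> (\<Sum>i=1..n. i * k i)"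
        by (rule member_le_sum) (use i in auto)
      also have "\<dots> = n" using k by (simp add: weighted_tuples_def)
      finally show ?thesis .
    qed
    thus "k \<in> {1..n} \<rightarrow>\<^sub>E {..n}"
      using k by (auto simp: weighted_tuples_def PiE_iff)
  qed
qed (auto intro!: finite_PiE)

lemma fps_prod_has_prod:
  fixes F :: "nat \<Rightarrow> int fps"
  assumes F: "\<And>k. fps_X ^ Suc k dvd F k - 1"
  shows "F has_prod (\<Prod>k. F k)" and "(\<lambda>N. \<Prod>k<N. F k) \<longlonglongrightarrow> (\<Prod>k. F k)"
proof -
  define P where "P = (\<lambda>N. \<Prod>k<N. F k)"
  have step: "fps_nth (P (Suc N)) n = fps_nth (P N) n" if "n \<le> N" for n N
  proof -
    obtain H where H: "F N - 1 = fps_X ^ Suc N * H" using F[of N] by (auto elim: dvdE)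
    have "P (Suc N) = P N + P N * (F N - 1)" by (simp add: P_def algebra_simps)
    also have "\<dots> = P N + fps_X ^ Suc N * (P N * H)" unfolding H by (simp add: algebra_simps)
    finally show ?thesis using that by (simp add: fps_X_power_mult_nth del: power_Suc)
  qed
  have stable: "fps_nth (P N) n = fps_nth (P n) n" if "n \<le> N" for n N
    using that by (induction N rule: dec_induct) (auto simp: step)
  define G where "G = Abs_fps (\<lambda>n. fps_nth (P n) n)"
  have lim: "P \<longlonglongrightarrow> G"
    by (rule tendsto_fpsI, rule eventually_sequentiallyI) (auto simp: G_def intro: stable)
  have "fps_nth G 0 = 1" by (simp add: G_def P_def)
  hence "G \<noteq> 0" by auto
  moreover have "(\<lambda>n. \<Prod>i\<le>n. F i) \<longlonglongrightarrow> G"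
    using lim unfolding P_def LIMSEQ_lessThan_iff_atMost[symmetric] .
  ultimately have "F has_prod G" by (simp add: has_prod_def raw_has_prod_def)
  moreover from this have "(\<Prod>k. F k) = G" using has_prod_unique by metis
  ultimately show "F has_prod (\<Prod>k. F k)" "(\<lambda>N. \<Prod>k<N. F k) \<longlonglongrightarrow> (\<Prod>k. F k)"
    using lim by (simp_all add: P_def)
qed

lemma lam_factor_dvd:
  assumes "a > 0" "b > 0"
  shows "(fps_X :: int fps) ^ Suc k dvd
           (1 - fps_X ^ (a * Suc k)) ^ 3 * (1 - fps_X ^ (b * Suc k)) ^ 3 - 1"
proof -
  define A :: "int fps" where "A = 1 - fps_X ^ (a * Suc k)"
  define B :: "int fps" where "B = 1 - fps_X ^ (b * Suc k)"
  have *: "fps_X ^ Suc k dvd (fps_X :: int fps) ^ (c * Suc k)" if "c > 0" for c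
    using that by (intro le_imp_power_dvd) (metis One_nat_def Suc_leI mult_le_mono1 nat_mult_1)
  have A: "fps_X ^ Suc k dvd A - 1" using *[OF assms(1)]
    by (simp add: A_def del: power_Suc mult_Suc_right)
  have B: "fps_X ^ Suc k dvd B - 1" using *[OF assms(2)]
    by (simp add: B_def del: power_Suc mult_Suc_right)
  have "A ^ 3 * B ^ 3 - 1 = (A - 1) * (A ^ 2 + A + 1) + (B - 1) * ((B ^ 2 + B + 1) * A ^ 3)"
    by (simp add: algebra_simps power2_eq_square power3_eq_cube)
  hence "fps_X ^ Suc k dvd A ^ 3 * B ^ 3 - 1" using A B by (metis dvd_add dvd_mult2)
  thus ?thesis by (simp only: A_def B_def)
qed

lemma lam_product_has_prod:
  assumes "a > 0" "b > 0"
  shows "(\<lambda>k. (1 - fps_X ^ (a * Suc k)) ^ 3 * (1 - fps_X ^ (b * Suc k)) ^ 3)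
           has_prod (\<Prod>k. (1 - fps_X ^ (a * Suc k)) ^ 3 * (1 - fps_X ^ (b * Suc k)) ^ 3 :: int fps)"
  by (rule fps_prod_has_prod, rule lam_factor_dvd) (use assms in auto)

definition cfps :: "int fps \<Rightarrow> complex fps" where
  "cfps F = Abs_fps (\<lambda>n. of_int (fps_nth F n))"

lemma cfps_nth: "fps_nth (cfps F) n = of_int (fps_nth F n)"
  by (simp add: cfps_def)

lemma cfps_simps:
  "cfps (F * G) = cfps F * cfps G" "cfps 1 = 1" "cfps (F - G) = cfps F - cfps G" "cfps fps_X = fps_X"
  by (auto simp: fps_eq_iff cfps_nth fps_mult_nth)

lemma cfps_power: "cfps (F ^ n) = cfps F ^ n"
  by (induction n) (auto simp: cfps_simps)

lemma cfps_prod: "cfps (\<Prod>k<N. f k) = (\<Prod>k<N. cfps (f k))" for N :: nat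
  by (induction N) (auto simp: cfps_simps)

lemma lam_factor_bound:
  fixes u v :: complex
  assumes "norm u \<le> t" "norm v \<le> t" "t \<le> 1"
  shows "norm ((1 - u) ^ 3 * (1 - v) ^ 3 - 1) \<le> 63 * t"
proof -
  define f where "f = (\<lambda>i::nat. if i < 3 then - u else - v)"
  have t: "0 \<le> t" using assms(1) norm_ge_zero order_trans by blast
  have "(1 - u) ^ 3 * (1 - v) ^ 3 - 1 = (\<Prod>i<6. 1 + f i) - 1"
    by (simp add: f_def eval_nat_numeral algebra_simps)
  also have "norm \<dots> \<le> (\<Prod>i<6. 1 + norm (f i)) - 1"
    by (rule norm_prod_minus1_le_prod_minus1)
  also have "(\<Prod>i<6. 1 + norm (f i)) \<le> (\<Prod>i<(6::nat). 1 + t)"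
    by (rule prod_mono) (use assms in \<open>auto simp: f_def\<close>)
  also have "\<dots> - 1 = t * (6 + 15 * t + 20 * t ^ 2 + 15 * t ^ 3 + 6 * t ^ 4 + t ^ 5)"
    by (simp add: eval_nat_numeral algebra_simps)
  also have "\<dots> \<le> t * (6 + 15 * 1 + 20 * 1 + 15 * 1 + 6 * 1 + 1)"
    by (intro mult_left_mono add_mono) (use t assms(3) in \<open>auto intro: power_le_one\<close>)
  finally show ?thesis by simp
qed

lemma lam_sums:
  fixes q :: complex
  assumes a: "a > 0" and b: "b > 0" and q: "norm q < 1"
  shows "(\<lambda>n. of_int (lam a b n) * q ^ n) sums
           (q * (\<Prod>k. (1 - q ^ (a * Suc k)) ^ 3 * (1 - q ^ (b * Suc k)) ^ 3))"
proof -
  define f where "f = (\<lambda>k (z::complex). (1 - z ^ (a * Suc k)) ^ 3 * (1 - z ^ (b * Suc k)) ^ 3)"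
  define F where "F = (\<lambda>k. (1 - fps_X ^ (a * Suc k)) ^ 3 * (1 - fps_X ^ (b * Suc k)) ^ 3 :: int fps)"
  define L where "L = (\<lambda>z. \<Prod>k. f k z)"
  have bound: "norm (f k z - 1) \<le> 63 * r ^ Suc k" if "norm z \<le> r" "r < 1" for k z r
  proof -
    have r: "0 \<le> r" using that(1) norm_ge_zero order_trans by blast
    have *: "norm (z ^ (c * Suc k)) \<le> r ^ Suc k" if "c > 0" for c
    proof -
      have "norm (z ^ (c * Suc k)) \<le> r ^ (c * Suc k)"
        using \<open>norm z \<le> r\<close> by (simp add: norm_power power_mono del: mult_Suc_right)
      also have "\<dots> \<le> r ^ Suc k"
        using r \<open>r < 1\<close> \<open>c > 0\<close>
        by (intro power_decreasing) (auto simp del: mult_Suc_right)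
      finally show ?thesis .
    qed
    show ?thesis unfolding f_def
      by (intro lam_factor_bound * a b power_le_one) (use r that in auto)
  qed
  have summ: "summable (\<lambda>k. 63 * r ^ Suc k)" if "0 \<le> r" "r < 1" for r :: real
    using that by (intro summable_mult) (auto simp: summable_Suc_iff intro!: summable_geometric
      simp del: power_Suc)
  have unif: "uniform_limit (cball 0 r) (\<lambda>N z. \<Prod>k<N. f k z) L sequentially"
    if r: "0 \<le> r" "r < 1" for r
  proof -
    have "uniformly_convergent_on (cball 0 r) (\<lambda>N z. \<Sum>k<N. norm (f k z - 1))"
      by (rule Weierstrass_m_test'[OF _ summ[OF r]]) (use bound r in auto)
    hence "uniformly_convergent_on (cball 0 r) (\<lambda>N z. \<Prod>k<N. f k z)"
      by (intro uniformly_convergent_on_prod') (auto simp: f_def intro!: continuous_intros)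
    then obtain l where l: "uniform_limit (cball 0 r) (\<lambda>N z. \<Prod>k<N. f k z) l sequentially"
      by (auto simp: uniformly_convergent_on_def)
    have "l z = L z" if z: "z \<in> cball 0 r" for z
    proof (rule LIMSEQ_unique)
      show "(\<lambda>N. \<Prod>k<N. f k z) \<longlonglongrightarrow> l z" by (rule tendsto_uniform_limitI[OF l z])
      have "summable (\<lambda>k. norm (f k z - 1))"
        by (rule summable_comparison_test'[OF summ[OF r], of 0]) (use bound[of z r] r z in auto)
      hence "convergent_prod (\<lambda>k. f k z)"
        by (intro abs_convergent_prod_imp_convergent_prod) (simp add: abs_convergent_prod_conv_summable)
      hence "(\<lambda>N. \<Prod>k\<le>N. f k z) \<longlonglongrightarrow> L z" unfolding L_def by (rule convergent_prod_LIMSEQ)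
      thus "(\<lambda>N. \<Prod>k<N. f k z) \<longlonglongrightarrow> L z" by (simp add: LIMSEQ_lessThan_iff_atMost)
    qed
    thus ?thesis using l by (subst uniform_limit_cong'[where i = l]) auto
  qed
  have holo: "L holomorphic_on ball 0 1"
  proof (rule holomorphic_uniform_sequence[where f = "\<lambda>N z. \<Prod>k<N. f k z"])
    fix x :: complex assume x: "x \<in> ball 0 1"
    define d where "d = (1 - norm x) / 2"
    have "cball x d \<subseteq> cball 0 ((1 + norm x) / 2)"
    proof
      fix y assume "y \<in> cball x d"
      moreover have "norm y \<le> norm x + norm (y - x)" by norm
      ultimately show "y \<in> cball 0 ((1 + norm x) / 2)"
        by (simp add: d_def dist_norm norm_minus_commute field_simps)
    qed
    moreover have "uniform_limit (cball 0 ((1 + norm x) / 2)) (\<lambda>N z. \<Prod>k<N. f k z) L sequentially"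
      by (rule unif) (use x in auto)
    moreover have "d > 0" "cball x d \<subseteq> ball 0 1"
    proof -
      show "d > 0" using x by (simp add: d_def)
      show "cball x d \<subseteq> ball 0 1"
        using \<open>cball x d \<subseteq> cball 0 ((1 + norm x) / 2)\<close> x by fastforce
    qed
    ultimately show "\<exists>d. 0 < d \<and> cball x d \<subseteq> ball 0 1 \<and>
        uniform_limit (cball x d) (\<lambda>N z. \<Prod>k<N. f k z) L sequentially"
      using uniform_limit_on_subset by blast
  qed (auto simp: f_def intro!: holomorphic_intros)
  have exp_f: "f k has_fps_expansion cfps (F k)" for k
    unfolding f_def F_def cfps_simps cfps_power by (intro fps_expansion_intros)
  have expL: "L has_fps_expansion fps_expansion L 0"
    using holo by (intro has_fps_expansion_fps_expansion[of "ball 0 1"]) auto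
  have "fps_expansion L 0 = cfps (\<Prod>k. F k)"
  proof (rule uniform_limit_imp_fps_expansion_eq)
    have "(\<lambda>N. \<Prod>k<N. F k) \<longlonglongrightarrow> (\<Prod>k. F k)"
      by (rule fps_prod_has_prod) (use lam_factor_dvd[OF a b] in \<open>simp add: F_def\<close>)
    thus "(\<lambda>N. cfps (\<Prod>k<N. F k)) \<longlonglongrightarrow> cfps (\<Prod>k. F k)"
      unfolding tendsto_fps_iff cfps_nth of_int_eq_iff .
    show "uniform_limit (ball 0 (1/2)) (\<lambda>N z. \<Prod>k<N. f k z) L sequentially"
      by (rule uniform_limit_on_subset[OF unif[of "1/2"]]) auto
    show "\<forall>\<^sub>F N in sequentially. (\<lambda>z. \<Prod>k<N. f k z) has_fps_expansion cfps (\<Prod>k<N. F k)"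
      by (intro always_eventually allI) (auto simp: cfps_prod intro!: has_fps_expansion_prod exp_f)
    show "\<forall>\<^sub>F N in sequentially. (\<lambda>z. \<Prod>k<N. f k z) holomorphic_on ball 0 (1/2)"
      by (intro always_eventually allI) (auto simp: f_def intro!: holomorphic_intros)
  qed (use expL in auto)
  hence "(\<lambda>z. z * L z) has_fps_expansion fps_X * cfps (\<Prod>k. F k)"
    using expL by (auto intro!: fps_expansion_intros)
  hence "(\<lambda>n. fps_nth (fps_X * cfps (\<Prod>k. F k)) n * q ^ n) sums (q * L q)"
    by (rule has_fps_expansion_imp_sums_complex[where r = 1])
       (use holo q in \<open>auto intro!: holomorphic_intros simp: eball_def one_ereal_def ball_def\<close>)
  moreover have "fps_nth (fps_X * cfps (\<Prod>k. F k)) n = of_int (lam a b n)" for n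
    unfolding lam_def F_def[symmetric] cfps_nth[symmetric] by (simp add: cfps_simps F_def)
  ultimately show ?thesis by (simp add: L_def f_def)
qed

text \<open>
  These show that \<open>(a + b) * (p - 1) div 8\<close> is exact when \<open>a * b\<close> is odd, and that
  \<open>y div 2\<close> is exact in the case of even \<open>b\<close>.
\<close>

lemma eight_dvd_odd_case:
  fixes a b p :: nat and x y :: int
  assumes "odd (a * b)" "odd p" "int p = x ^ 2 + int a * int b * y ^ 2"
  shows "8 dvd (a + b) * (p - 1)"
proof -
  from assms(1) obtain i j where "a = 2 * i + 1" "b = 2 * j + 1" by (auto elim!: oddE)
  define A B where "A = int a" and "B = int b"
  define I J where "I = int i" and "J = int j"
  have AB: "A = 2 * I + 1" "B = 2 * J + 1"
    using \<open>a = 2 * i + 1\<close> \<open>b = 2 * j + 1\<close> by (simp_all add: A_def B_def I_def J_def)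
  have p: "int p = x ^ 2 + A * B * y ^ 2" using assms(3) by (simp add: A_def B_def)
  have "odd (int p)" using assms(2) by simp
  hence xy: "odd x \<noteq> odd y" unfolding p AB by auto
  have "8 dvd (A + B) * (int p - 1)"
  proof (cases "even y")
    case True
    then obtain u v where uv: "x = 2 * u + 1" "y = 2 * v" using xy by (auto elim!: oddE evenE)
    have "(A + B) * (int p - 1) = 8 * ((I + J + 1) * (u ^ 2 + u + A * B * v ^ 2))"
      unfolding p uv unfolding AB by (simp add: algebra_simps power2_eq_square)
    thus ?thesis by simp
  next
    case False
    then obtain u v where uv: "x = 2 * u" "y = 2 * v + 1" using xy by (auto elim!: oddE evenE)
    have "even ((I + J + 1) * (2 * I * J + I + J))" by auto
    then obtain w where w: "(I + J + 1) * (2 * I * J + I + J) = 2 * w" by (rule evenE)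
    have "(A + B) * (int p - 1) =
            8 * ((I + J + 1) * (u ^ 2 + A * B * (v ^ 2 + v))) + 4 * ((I + J + 1) * (2 * I * J + I + J))"
      unfolding p uv unfolding AB by (simp add: algebra_simps power2_eq_square)
    also have "\<dots> = 8 * ((I + J + 1) * (u ^ 2 + A * B * (v ^ 2 + v)) + w)" unfolding w by simp
    finally show ?thesis by simp
  qed
  also have "(A + B) * (int p - 1) = int ((a + b) * (p - 1))"
    using assms(2) by (cases p) (simp_all add: A_def B_def)
  finally show ?thesis by presburger
qed

lemma even_y_even_case:
  fixes a b p :: nat and x y :: int
  assumes "odd a" "even b" "\<not> 8 dvd b" "odd p" "8 dvd p - 1" "int p = x ^ 2 + int a * int b * y ^ 2"
  shows "even y"
proof (rule ccontr)
  assume y: "odd y"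
  have "odd (int p)" using assms(4) by simp
  hence "odd x" unfolding assms(6) using assms(2) by auto
  then obtain u where u: "x = 2 * u + 1" by (auto elim: oddE)
  obtain w where w: "u * (u + 1) = 2 * w" by (metis even_mult_iff even_plus_one_iff evenE)
  have "int (p - 1) = int p - 1" using assms(4) by (cases p) auto
  hence "8 dvd int p - 1" using assms(5) by (metis int_dvd_int_iff of_nat_numeral)
  moreover have "int p - 1 = 8 * w + int b * (int a * y ^ 2)"
    using w unfolding assms(6) u by (simp add: algebra_simps power2_eq_square)
  ultimately have "8 dvd int b * (int a * y ^ 2)"
    by (metis dvd_add_right_iff dvd_triv_left)
  moreover have "coprime 8 (int a * y ^ 2)"
    using assms(1) y coprime_power_left_iff[of 2 3 "int a * y ^ 2"] by simp
  ultimately have "8 dvd int b" by (simp add: coprime_dvd_mult_left_iff)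
  thus False using assms(3) by (metis int_dvd_int_iff of_nat_numeral)
qed

end

theory Submission
  imports Defs "HOL-Library.Nat_Bijection"
begin

text \<open>
  By Jacobi's identity $\prod_k (1-q^k)^3 = \sum_{m\ge0} (-1)^m (2m+1) q^{m(m+1)/2}$
  (\<open>jacobi_cube_mod\<close>), the number $\lambda(a,b;n+1)$ is the sum of
  $(-1)^{m+l}(2m+1)(2l+1)$ over all $m, l \ge 0$ with $a\,m(m+1)/2 + b\,l(l+1)/2 = n$
  (\<open>lam_eq_double_sum\<close>). With $u = 2m+1$, $v = 2l+1$ and $8n = (a+b)(p-1)$ this condition reads
  \[ au^2 + bv^2 = (a+b)p, \qquad u, v > 0 \mbox{ odd}. \]
  Composing $p = x^2 + aby^2$ with the representation $a \cdot 1^2 + b \cdot 1^2$ of $a+b$ in two ways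
  gives the solutions $(u,v) = (|x+by|, |x-ay|)$ and $(|x-by|, |x+ay|)$. There are no others
  (\<open>representation_unique\<close>): because $p$ is prime, every solution can be divided by
  $(x,y)$, and the quotient is an integral point on $aU^2+bV^2=a+b$, which the parity of $u$ and $v$
  together with $8 \nmid b$ forces to be $(\pm1,\pm1)$. The two contributions have the same sign and add up to $\pm 2(x^2-aby^2)$, that is
  $\pm(4x^2-2p)$; the sign is read off from $(x+by)(x-ay)$ modulo $4$.

  For the second equality, $\log\bigl(\prod_k (1-q^{ak})^3(1-q^{bk})^3\bigr) = \sum_{i\ge1} -3s_iq^i/i$
  with $s_i = a\,\sigma(i/a) + b\,\sigma(i/b)$, and expanding the exponential of this series factor by
  factor gives the sum over tuples. The comparison is made through logarithmic derivatives, which turn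
  into a recurrence for the coefficients (\<open>lam_eq_sigma_sum\<close>).
\<close>


section \<open>Gaussian binomial coefficients and Jacobi's identity\<close>

definition qpoch :: "'a::comm_ring_1 \<Rightarrow> nat \<Rightarrow> 'a" where
  "qpoch q n = (\<Prod>i<n. 1 - q ^ Suc i)"

text \<open>
  The Gaussian binomial coefficient is given by its Pascal recurrence, because the quotient of
  \<^const>\<open>qpoch\<close> values that usually defines it need not exist in a commutative ring.
\<close>

fun gbinom :: "'a::comm_ring_1 \<Rightarrow> nat \<Rightarrow> nat \<Rightarrow> 'a" where
  "gbinom q n 0 = 1"
| "gbinom q 0 (Suc k) = 0"
| "gbinom q (Suc n) (Suc k) = gbinom q n k + q ^ Suc k * gbinom q n (Suc k)"

lemma gbinom_eq_0: "n < k \<Longrightarrow> gbinom q n k = 0"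
  by (induction q n k rule: gbinom.induct) auto

text \<open>
  The other $q$-Pascal rule, in which the power of $q$ sits on the term with the smaller lower index.
  Alternating the two rules gives symmetry and the two-step recurrence.
\<close>

lemma gbinom_Suc_Suc':
  "k \<le> n \<Longrightarrow> gbinom q (Suc n) (Suc k) = q ^ (n - k) * gbinom q n k + gbinom q n (Suc k)"
proof (induction n arbitrary: k)
  case (Suc n)
  show ?case
  proof (cases k)
    case 0
    have "gbinom q (Suc (Suc n)) (Suc 0) = 1 + q * gbinom q (Suc n) (Suc 0)" by simp
    also have "\<dots> = 1 + q * (q ^ n + gbinom q n (Suc 0))" using Suc.IH[of 0] by simp
    also have "\<dots> = q ^ Suc n + gbinom q (Suc n) (Suc 0)" by (simp add: algebra_simps)
    finally show ?thesis using 0 by simp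
  next
    case (Suc j)
    with Suc.prems have j: "j \<le> n" by simp
    show ?thesis
    proof (cases "j = n")
      case True
      thus ?thesis using Suc by (simp add: gbinom_eq_0)
    next
      case False
      hence *: "Suc j \<le> n" using j by simp
      have pw: "q ^ (n - j) = q * q ^ (n - Suc j)"
        using * by (metis Suc_diff_le diff_Suc_Suc power_Suc)
      have "gbinom q (Suc (Suc n)) (Suc k)
          = gbinom q (Suc n) (Suc j) + q ^ Suc k * gbinom q (Suc n) (Suc k)"
        using Suc by simp
      also have "\<dots> = q ^ (n - j) * gbinom q n j + gbinom q n (Suc j)
          + q ^ Suc k * (q ^ (n - Suc j) * gbinom q n (Suc j) + gbinom q n (Suc k))"
        using Suc.IH[OF j] Suc.IH[OF *] Suc by simp
      also have "\<dots> = q ^ (n - j) * gbinom q (Suc n) (Suc j) + gbinom q (Suc n) (Suc k)"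
        using Suc pw by (simp add: algebra_simps)
      finally show ?thesis using Suc by simp
    qed
  qed
qed simp

lemma gbinom_self: "gbinom q n n = 1"
  by (induction n) (auto simp: gbinom_eq_0)

lemma gbinom_symmetric: "gbinom q (j + k) j = gbinom q (j + k) k"
proof (induction "j + k" arbitrary: j k)
  case (Suc n)
  show ?case
  proof (cases j; cases k)
    fix j' k' assume jk: "j = Suc j'" "k = Suc k'"
    have n: "n = j' + Suc k'" "n = Suc j' + k'" using Suc.hyps(2) jk by auto
    have "gbinom q (Suc n) (Suc j') = gbinom q n j' + q ^ Suc j' * gbinom q n (Suc j')" by simp
    also have "\<dots> = gbinom q n (Suc k') + q ^ (n - k') * gbinom q n k'"
      using Suc.hyps(1)[OF n(1)] Suc.hyps(1)[OF n(2)] n by simp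
    also have "\<dots> = gbinom q (Suc n) (Suc k')"
      using gbinom_Suc_Suc'[of k' n q] n by simp
    finally show ?thesis using Suc.hyps(2) jk by simp
  qed (use Suc.hyps(2) in \<open>auto simp: gbinom_self\<close>)
qed simp

text \<open>
  Going from $n$ to $n+2$ corresponds to one more factor on each side of the central one in the
  triple product, and this is the step taken in the induction for \<open>qpoch_square\<close>.
\<close>

lemma gbinom_two_step:
  assumes "Suc k \<le> n"
  shows "gbinom q (Suc (Suc n)) (Suc (Suc k)) =
    q ^ (k + 2) * gbinom q n (k + 2) + (1 + q ^ Suc n) * gbinom q n (Suc k) + q ^ (n - k) * gbinom q n k"
proof -
  have pw: "q ^ (k + 2) * q ^ (n - Suc k) = q ^ Suc n"
    using assms by (simp del: power_Suc flip: power_add)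
  have "gbinom q (Suc (Suc n)) (Suc (Suc k))
      = gbinom q (Suc n) (Suc k) + q ^ (k + 2) * gbinom q (Suc n) (Suc (Suc k))" by simp
  also have "\<dots> = q ^ (n - k) * gbinom q n k + gbinom q n (Suc k)
      + q ^ (k + 2) * (q ^ (n - Suc k) * gbinom q n (Suc k) + gbinom q n (k + 2))"
    using gbinom_Suc_Suc'[of k n q] gbinom_Suc_Suc'[of "Suc k" n q] assms by simp
  also have "\<dots> = q ^ (k + 2) * gbinom q n (k + 2)
      + (gbinom q n (Suc k) + (q ^ (k + 2) * q ^ (n - Suc k)) * gbinom q n (Suc k)) + q ^ (n - k) * gbinom q n k"
    by (simp only: algebra_simps)
  finally show ?thesis unfolding pw by (simp add: algebra_simps)
qed

text \<open>
  Half of the quotient formula for Gaussian binomials, cleared of denominators so that it holds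
  without any cancellation property of the ring.
\<close>

lemma gbinom_mult_qpoch:
  "k \<le> n \<Longrightarrow> gbinom q n k * qpoch q k = (\<Prod>i<k. 1 - q ^ (n - i))"
proof (induction q n k rule: gbinom.induct)
  case (3 q n k)
  have pw: "q ^ Suc k * q ^ (n - k) = q ^ Suc n" using 3 by (simp del: power_Suc flip: power_add)
  have *: "gbinom q n (Suc k) * qpoch q (Suc k) = (\<Prod>i<k. 1 - q ^ (n - i)) * (1 - q ^ (n - k))"
  proof (cases "Suc k \<le> n")
    case True
    thus ?thesis using 3 by simp
  next
    case False
    thus ?thesis using 3 by (simp add: gbinom_eq_0)
  qed
  have "gbinom q (Suc n) (Suc k) * qpoch q (Suc k)
      = (gbinom q n k * qpoch q k) * (1 - q ^ Suc k) + q ^ Suc k * (gbinom q n (Suc k) * qpoch q (Suc k))"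
    by (simp add: qpoch_def algebra_simps)
  also have "\<dots> = (\<Prod>i<k. 1 - q ^ (n - i)) * (1 - q ^ Suc k * q ^ (n - k))"
    unfolding * using 3 by (simp add: algebra_simps)
  also have "\<dots> = (\<Prod>i<Suc k. 1 - q ^ (Suc n - i))"
    unfolding pw by (subst prod.lessThan_Suc_shift) simp
  finally show ?case .
qed (auto simp: qpoch_def)

text \<open>
  The finite Jacobi triple product
  \[ \prod_{i=1}^n (1-zq^i)(1-z^{-1}q^i)
     = \sum_{m=0}^n (-1)^m q^{m(m+1)/2} {2n+1 \brack n-m} (z^m + z^{m-1} + \cdots + z^{-m}) \]
  at $z=1$. For general $z$ the Laurent polynomials $\chi_m = z^m + \cdots + z^{-m}$ satisfy
  $(z+z^{-1})\chi_m = \chi_{m+1} + \chi_{m-1}$ with $\chi_{-1} = -\chi_0$; at $z=1$ they become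
  $2m+1$, and the relation becomes $2(2m+1) = (2m+3) + (2m-1)$, which is all that the induction on $n$
  needs. Thus neither a second variable nor a derivative in $z$ enters.
\<close>

lemma qpoch_square:
  fixes q :: "'a::comm_ring_1"
  shows "qpoch q n ^ 2 =
    (\<Sum>m\<le>n. (-1) ^ m * of_nat (2 * m + 1) * q ^ triangle m * gbinom q (2 * n + 1) (n - m))"
proof -
  define c where "c = (\<lambda>n m. if m \<le> n then gbinom q (2 * n + 1) (n - m) else 0)"
  have c0: "c n m = 0" if "n < m" for n m using that by (simp add: c_def)
  have rec_Suc: "c (Suc n) (Suc m) = (1 + q ^ (2 * n + 2)) * c n (Suc m) + q ^ (n - m) * c n m
      + q ^ (n + m + 3) * c n (Suc (Suc m))" if "m \<le> n" for n m
  proof -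
    have "m = n \<or> Suc m = n \<or> (\<exists>k. n = m + 2 + k)" using that by presburger
    then consider "m = n" | "Suc m = n" | k where "n = m + 2 + k" by blast
    thus ?thesis
    proof cases
      case 1
      thus ?thesis by (simp add: c_def)
    next
      case 2
      have "gbinom q (Suc (2 * n + 1)) (Suc 0) = q ^ (2 * n + 1) + gbinom q (2 * n + 1) (Suc 0)"
        using gbinom_Suc_Suc'[of 0 "2 * n + 1" q] by simp
      thus ?thesis using 2 by (auto simp: c_def algebra_simps)
    next
      case 3
      have "gbinom q (Suc (Suc (2 * n + 1))) (Suc (Suc k)) =
          q ^ (k + 2) * gbinom q (2 * n + 1) (k + 2) + (1 + q ^ Suc (2 * n + 1)) * gbinom q (2 * n + 1) (Suc k)
            + q ^ (2 * n + 1 - k) * gbinom q (2 * n + 1) k"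
        by (rule gbinom_two_step) (use 3 in simp)
      moreover have "2 * n + 1 - k = n + m + 3" using 3 by simp
      ultimately show ?thesis using 3 by (simp add: c_def add_ac del: gbinom.simps)
    qed
  qed
  \<comment> \<open>The missing neighbour at index \<open>-1\<close> equals the one at \<open>0\<close> by symmetry of the
    Gaussian binomial, whence the extra middle term.\<close>
  have rec_0: "c (Suc n) 0 = (1 + q ^ (2 * n + 2)) * c n 0 + q ^ Suc n * c n 0 + q ^ (n + 2) * c n 1" for n
  proof (cases n)
    case 0
    thus ?thesis by (simp add: c_def numeral_eq_Suc algebra_simps)
  next
    case (Suc k)
    have "gbinom q (Suc (Suc (2 * n + 1))) (Suc (Suc k)) =
        q ^ (k + 2) * gbinom q (2 * n + 1) (k + 2) + (1 + q ^ Suc (2 * n + 1)) * gbinom q (2 * n + 1) (Suc k)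
          + q ^ (2 * n + 1 - k) * gbinom q (2 * n + 1) k"
      by (rule gbinom_two_step) (use Suc in simp)
    moreover have "gbinom q (2 * n + 1) (k + 2) = gbinom q (2 * n + 1) (Suc k)"
      using gbinom_symmetric[of q "k + 2" "Suc k"] Suc by (simp del: gbinom.simps add: mult_2)
    moreover have "2 * n + 1 - k = n + 2" using Suc by simp
    ultimately show ?thesis using Suc by (simp add: c_def numeral_3_eq_3 algebra_simps del: gbinom.simps)
  qed
  have "qpoch q n ^ 2 = (\<Sum>m\<le>n. (-1) ^ m * of_nat (2 * m + 1) * q ^ triangle m * c n m)"
  proof (induction n)
    case 0
    show ?case by (simp add: qpoch_def c_def)
  next
    case (Suc n)
    define w where "w = (\<lambda>m. (-1) ^ m * q ^ triangle m * c n m)"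
    define Q where "Q = q ^ Suc n"
    have w0: "w (Suc n) = 0" "w (Suc (Suc n)) = 0" by (simp_all add: w_def c0)
    have QQ: "q ^ (2 * n + 2) = Q ^ 2" 
      unfolding Q_def power_mult[symmetric] by (intro arg_cong[where f = "(^) q"]) simp
    have step: "(-1) ^ Suc m * of_nat (2 * Suc m + 1) * q ^ triangle (Suc m) * c (Suc n) (Suc m)
       = (1 + Q\<^sup>2) * (of_nat (2 * Suc m + 1) * w (Suc m)) - Q * (of_nat (2 * m + 3) * w m)
         - Q * (of_nat (2 * m + 3) * w (Suc (Suc m)))" if "m \<le> n" for m
    proof -
      have 1: "q ^ triangle (Suc m) * q ^ (n - m) = Q * q ^ triangle m"
        unfolding Q_def power_add[symmetric] using that by (intro arg_cong[where f = "(^) q"]) simp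
      have 2: "q ^ triangle (Suc m) * q ^ (n + m + 3) = Q * q ^ triangle (Suc (Suc m))"
        unfolding Q_def power_add[symmetric] by (intro arg_cong[where f = "(^) q"]) simp
      have "(-1) ^ Suc m * of_nat (2 * Suc m + 1) * q ^ triangle (Suc m) * c (Suc n) (Suc m)
         = (-1) ^ Suc m * of_nat (2 * m + 3) * ((1 + Q\<^sup>2) * q ^ triangle (Suc m) * c n (Suc m)
           + (q ^ triangle (Suc m) * q ^ (n - m)) * c n m
           + (q ^ triangle (Suc m) * q ^ (n + m + 3)) * c n (Suc (Suc m)))"
        unfolding rec_Suc[OF that] QQ by (simp add: algebra_simps del: triangle_Suc)
      also have "\<dots> = (1 + Q\<^sup>2) * (of_nat (2 * Suc m + 1) * w (Suc m)) - Q * (of_nat (2 * m + 3) * w m)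
         - Q * (of_nat (2 * m + 3) * w (Suc (Suc m)))"
        unfolding 1 2 w_def by (simp add: algebra_simps del: triangle_Suc)
      finally show ?thesis .
    qed
    \<comment> \<open>The three shifted sums are brought back to sums over \<open>w m\<close>; the boundary terms \<open>w 0\<close>
      and \<open>w 1\<close> cancel against those of \<open>c (Suc n) 0\<close>.\<close>
    define A where "A = (\<Sum>m\<le>n. of_nat (2 * m + 1) * w m)"
    have A1: "(\<Sum>m\<le>n. of_nat (2 * Suc m + 1) * w (Suc m)) = A - w 0"
    proof -
      have "(\<Sum>m\<le>Suc n. of_nat (2 * m + 1) * w m) = A" by (simp add: A_def w0)
      thus ?thesis by (subst (asm) sum.atMost_Suc_shift) (simp add: algebra_simps)
    qed
    define C where "C = (\<Sum>m\<le>n. of_nat (2 * m) * w m) - (\<Sum>m\<le>n. w m)"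
    have C1: "(\<Sum>m\<le>n. of_nat (2 * m + 3) * w (Suc (Suc m))) = C + w 0 - w 1"
    proof -
      have "C = (\<Sum>m\<le>Suc (Suc n). of_nat (2 * m) * w m - w m)" by (simp add: C_def w0 sum_subtractf)
      also have "\<dots> = - w 0 + w 1 + (\<Sum>m\<le>n. of_nat (2 * Suc (Suc m)) * w (Suc (Suc m)) - w (Suc (Suc m)))"
        unfolding sum.atMost_Suc_shift[of _ "Suc n"] sum.atMost_Suc_shift[of _ n] by simp
      also have "(\<Sum>m\<le>n. of_nat (2 * Suc (Suc m)) * w (Suc (Suc m)) - w (Suc (Suc m)))
          = (\<Sum>m\<le>n. of_nat (2 * m + 3) * w (Suc (Suc m)))"
        by (rule sum.cong) (simp_all add: algebra_simps)
      finally show ?thesis by simp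
    qed
    have AC: "(\<Sum>m\<le>n. of_nat (2 * m + 3) * w m) + C = 2 * A"
      unfolding A_def C_def sum_distrib_left sum.distrib[symmetric] sum_subtractf[symmetric]
      by (rule sum.cong) (simp_all add: algebra_simps)
    have "(\<Sum>m\<le>Suc n. (-1) ^ m * of_nat (2 * m + 1) * q ^ triangle m * c (Suc n) m)
       = c (Suc n) 0 + (\<Sum>m\<le>n. (-1) ^ Suc m * of_nat (2 * Suc m + 1) * q ^ triangle (Suc m) * c (Suc n) (Suc m))"
      by (subst sum.atMost_Suc_shift) simp
    also have "\<dots> = c (Suc n) 0 + (\<Sum>m\<le>n. (1 + Q\<^sup>2) * (of_nat (2 * Suc m + 1) * w (Suc m))
        - Q * (of_nat (2 * m + 3) * w m) - Q * (of_nat (2 * m + 3) * w (Suc (Suc m))))"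
      by (intro arg_cong2[where f = "(+)"] refl sum.cong step) simp
    also have "\<dots> = c (Suc n) 0 + (1 + Q\<^sup>2) * (A - w 0) - Q * (\<Sum>m\<le>n. of_nat (2 * m + 3) * w m)
        - Q * (C + w 0 - w 1)"
      unfolding A1[symmetric] C1[symmetric] by (simp only: sum_subtractf sum_distrib_left add_diff_eq)
    also have "\<dots> = c (Suc n) 0 + (1 + Q\<^sup>2) * (A - w 0) - Q * (2 * A + w 0 - w 1)"
      unfolding AC[symmetric] by (simp add: algebra_simps)
    also have "c (Suc n) 0 = (1 + Q\<^sup>2) * w 0 + Q * w 0 - Q * w 1"
      unfolding rec_0 QQ by (simp add: w_def Q_def algebra_simps)
    finally have "(\<Sum>m\<le>Suc n. (-1) ^ m * of_nat (2 * m + 1) * q ^ triangle m * c (Suc n) m) = (1 - Q)\<^sup>2 * A"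
      by (simp add: algebra_simps power2_eq_square)
    moreover have "qpoch q n ^ 2 = A"
      unfolding Suc.IH A_def w_def by (rule sum.cong) (simp_all add: algebra_simps)
    hence "qpoch q (Suc n) ^ 2 = (1 - Q)\<^sup>2 * A"
      by (simp add: qpoch_def power_mult_distrib Q_def mult.commute)
    ultimately show ?case by simp
  qed
  thus ?thesis by (simp add: c_def)
qed

lemma prod_congruent_dvd:
  fixes d :: "'a::comm_ring_1"
  assumes "\<And>i. i \<in> A \<Longrightarrow> d dvd f i - g i"
  shows "d dvd prod f A - prod g A"
  using assms
proof (induction A rule: infinite_finite_induct)
  case (insert i A)
  have "prod f (insert i A) - prod g (insert i A) = f i * (prod f A - prod g A) + (f i - g i) * prod g A"
    using insert by (simp add: algebra_simps)
  thus ?case using insert by (metis dvd_add dvd_mult dvd_mult2 insertCI)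
qed auto

text \<open>
  Jacobi's identity $\prod_k (1-q^k)^3 = \sum_m (-1)^m (2m+1) q^{m(m+1)/2}$ modulo $q^{n+1}$.
  After multiplying \<open>qpoch_square\<close> by one more \<^term>\<open>qpoch q n\<close>, the cofactor of the $m$-th term is
  $1$ up to multiples of $q^{n-m+1}$, and $m(m+1)/2 + (n-m+1) \ge n+1$. The congruence holds for any
  ring element $q$, so it applies to both powers \<open>fps_X ^ a\<close> and \<open>fps_X ^ b\<close>.
\<close>

theorem jacobi_cube_mod:
  fixes q :: "'a::comm_ring_1"
  shows "q ^ Suc n dvd qpoch q n ^ 3 - (\<Sum>m\<le>n. (-1) ^ m * of_nat (2 * m + 1) * q ^ triangle m)"
proof -
  have cong: "q ^ Suc k dvd qpoch q n * gbinom q (2 * n + 1) k - 1" if "k \<le> n" for k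
  proof -
    have "qpoch q n = qpoch q k * (\<Prod>i\<in>{k..<n}. 1 - q ^ Suc i)"
      unfolding qpoch_def lessThan_atLeast0
      by (rule prod.atLeastLessThan_concat[symmetric]) (use that in auto)
    hence "qpoch q n * gbinom q (2 * n + 1) k
        = (gbinom q (2 * n + 1) k * qpoch q k) * (\<Prod>i\<in>{k..<n}. 1 - q ^ Suc i)"
      by (simp only: mult_ac)
    also have "gbinom q (2 * n + 1) k * qpoch q k = (\<Prod>i<k. 1 - q ^ (2 * n + 1 - i))"
      by (rule gbinom_mult_qpoch) (use that in simp)
    finally have eq: "qpoch q n * gbinom q (2 * n + 1) k
        = (\<Prod>i<k. 1 - q ^ (2 * n + 1 - i)) * (\<Prod>i\<in>{k..<n}. 1 - q ^ Suc i)" .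
    have 1: "q ^ Suc k dvd (\<Prod>i<k. 1 - q ^ (2 * n + 1 - i)) - (\<Prod>i<k. 1)"
      by (rule prod_congruent_dvd) (use that in \<open>auto simp del: power_Suc intro!: le_imp_power_dvd\<close>)
    have 2: "q ^ Suc k dvd (\<Prod>i\<in>{k..<n}. 1 - q ^ Suc i) - (\<Prod>i\<in>{k..<n}. 1)"
      by (rule prod_congruent_dvd) (auto simp del: power_Suc intro!: le_imp_power_dvd)
    have "U * V - 1 = (U - 1) * V + (V - 1)" for U V :: 'a by (simp add: algebra_simps)
    thus ?thesis unfolding eq using 1 2 by (metis dvd_add dvd_mult2 prod.neutral_const)
  qed
  have "qpoch q n ^ 3 - (\<Sum>m\<le>n. (-1) ^ m * of_nat (2 * m + 1) * q ^ triangle m)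
     = qpoch q n * qpoch q n ^ 2 - (\<Sum>m\<le>n. (-1) ^ m * of_nat (2 * m + 1) * q ^ triangle m)"
    by (simp add: power3_eq_cube power2_eq_square mult.assoc)
  also have "\<dots> = (\<Sum>m\<le>n. ((-1) ^ m * of_nat (2 * m + 1)) * (q ^ triangle m *
      (qpoch q n * gbinom q (2 * n + 1) (n - m) - 1)))"
    unfolding qpoch_square sum_distrib_left sum_subtractf[symmetric]
    by (rule sum.cong) (simp_all add: algebra_simps)
  also have "q ^ Suc n dvd \<dots>"
  proof (rule dvd_sum, rule dvd_mult)
    fix m assume "m \<in> {..n}"
    hence m: "m \<le> n" by simp
    have "m \<le> triangle m" by (induction m) auto
    hence "q ^ Suc n dvd q ^ triangle m * q ^ Suc (n - m)"
      using m by (auto simp flip: power_add simp del: power_Suc intro!: le_imp_power_dvd)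
    also have "\<dots> dvd q ^ triangle m * (qpoch q n * gbinom q (2 * n + 1) (n - m) - 1)"
      by (intro mult_dvd_mono cong) auto
    finally show "q ^ Suc n dvd q ^ triangle m * (qpoch q n * gbinom q (2 * n + 1) (n - m) - 1)" .
  qed
  finally show ?thesis .
qed


section \<open>The coefficients as sums over pairs of triangular numbers\<close>

lemma fps_X_power_dvd_iff: "fps_X ^ n dvd (F :: 'a::comm_ring_1 fps) \<longleftrightarrow> (\<forall>k<n. fps_nth F k = 0)"
proof
  assume "\<forall>k<n. fps_nth F k = 0"
  hence "F = fps_X ^ n * fps_shift n F"
    by (intro fps_ext) (auto simp: fps_X_power_mult_nth)
  thus "fps_X ^ n dvd F" by (metis dvd_triv_left)
qed (auto simp: fps_X_power_mult_nth elim!: dvdE)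

text \<open>
  In the topology of formal power series a limit is reached exactly at each fixed index, so that
  a coefficient of the infinite product is one of a finite product.
\<close>

lemma lam_eq_coeff:
  assumes "a > 0" "b > 0"
  shows "\<exists>N\<ge>n. lam a b (n + 1) = fps_nth (qpoch (fps_X ^ a) N ^ 3 * qpoch (fps_X ^ b) N ^ 3) n"
proof -
  define F where "F = (\<lambda>k. (1 - fps_X ^ (a * Suc k)) ^ 3 * (1 - fps_X ^ (b * Suc k)) ^ 3 :: int fps)"
  have "(\<lambda>N. \<Prod>k<N. F k) \<longlonglongrightarrow> (\<Prod>k. F k)"
    by (rule fps_prod_has_prod) (use lam_factor_dvd[OF assms] in \<open>simp add: F_def\<close>)
  hence "\<forall>\<^sub>F N in sequentially. fps_nth (\<Prod>k<N. F k) n = fps_nth (\<Prod>k. F k) n"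
    unfolding tendsto_fps_iff by blast
  hence "\<forall>\<^sub>F N in sequentially. fps_nth (\<Prod>k<N. F k) n = fps_nth (\<Prod>k. F k) n \<and> n \<le> N"
    using eventually_ge_at_top[of n] by (rule eventually_conj)
  then obtain N where N: "fps_nth (\<Prod>k<N. F k) n = fps_nth (\<Prod>k. F k) n" "n \<le> N"
    using eventually_happens[of _ sequentially] by auto
  have "(\<Prod>k<N. F k) = qpoch (fps_X ^ a) N ^ 3 * qpoch (fps_X ^ b) N ^ 3"
    by (simp add: F_def qpoch_def prod.distrib prod_power_distrib flip: power_mult del: power_Suc mult_Suc_right)
  moreover have "lam a b (n + 1) = fps_nth (\<Prod>k. F k) n" by (simp add: lam_def F_def)
  ultimately show ?thesis using N by auto
qed

text \<open>
  Jacobi's identity is applied to both cubes and the two truncated series are multiplied out;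
  the truncation point lies beyond every index that can contribute to the coefficient.
\<close>

lemma lam_eq_double_sum:
  assumes ab: "a > 0" "b > 0"
  shows "lam a b (n + 1) = (\<Sum>(m, l) | a * triangle m + b * triangle l = n.
           (-1) ^ m * int (2 * m + 1) * ((-1) ^ l * int (2 * l + 1)))"
proof -
  obtain N where N: "n \<le> N"
    "lam a b (n + 1) = fps_nth (qpoch (fps_X ^ a) N ^ 3 * qpoch (fps_X ^ b) N ^ 3) n"
    using lam_eq_coeff[OF ab] by blast
  define F :: "nat \<Rightarrow> int fps" where "F = (\<lambda>c. qpoch (fps_X ^ c) N ^ 3)"
  define j where "j = (\<lambda>m. (-1) ^ m * int (2 * m + 1))"
  define J :: "nat \<Rightarrow> int fps" where "J = (\<lambda>c. \<Sum>m\<le>N. fps_const (j m) * fps_X ^ (c * triangle m))"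
  have FJ: "fps_X ^ Suc n dvd F c - J c" if c: "c > 0" for c
  proof -
    have "(fps_X ^ c :: int fps) ^ Suc N dvd
        F c - (\<Sum>m\<le>N. (-1) ^ m * of_nat (2 * m + 1) * (fps_X ^ c) ^ triangle m)"
      unfolding F_def by (rule jacobi_cube_mod)
    also have "(\<Sum>m\<le>N. (-1) ^ m * of_nat (2 * m + 1) * (fps_X ^ c) ^ triangle m) = J c"
      unfolding J_def
    proof (rule sum.cong)
      fix m
      have "fps_const (j m) = (-1) ^ m * of_nat (2 * m + 1)"
        unfolding j_def fps_const_mult[symmetric] fps_const_power[symmetric] fps_of_nat[symmetric]
        by (simp add: fps_const_neg[symmetric] del: fps_const_neg)
      thus "(-1) ^ m * of_nat (2 * m + 1) * (fps_X ^ c) ^ triangle m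
          = fps_const (j m) * fps_X ^ (c * triangle m)"
        by (simp only: power_mult)
    qed simp
    finally have "(fps_X ^ c :: int fps) ^ Suc N dvd F c - J c" .
    moreover have "(fps_X :: int fps) ^ Suc n dvd (fps_X ^ c) ^ Suc N"
    proof -
      have "Suc n \<le> c * Suc N" using N(1) c by (metis Suc_leI Suc_le_mono mult_le_mono nat_mult_1 One_nat_def)
      thus ?thesis unfolding power_mult[symmetric] by (rule le_imp_power_dvd)
    qed
    ultimately show ?thesis by (rule dvd_trans[rotated])
  qed
  have "F a * F b - J a * J b = F a * (F b - J b) + (F a - J a) * J b" by (simp add: algebra_simps)
  hence "fps_X ^ Suc n dvd F a * F b - J a * J b"
    using FJ[OF ab(1)] FJ[OF ab(2)] by (metis dvd_add dvd_mult dvd_mult2)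
  hence "fps_nth (F a * F b) n = fps_nth (J a * J b) n"
    unfolding fps_X_power_dvd_iff by simp
  also have "J a * J b = (\<Sum>(m, l)\<in>{..N} \<times> {..N}. fps_const (j m * j l) * fps_X ^ (a * triangle m + b * triangle l))"
    unfolding J_def sum_product sum.cartesian_product
    by (intro sum.cong) (auto simp: power_add algebra_simps simp flip: fps_const_mult)
  also have "fps_nth \<dots> n = (\<Sum>(m, l)\<in>{..N} \<times> {..N}. if a * triangle m + b * triangle l = n then j m * j l else 0)"
    unfolding fps_sum_nth by (intro sum.cong) auto
  also have "\<dots> = (\<Sum>(m, l) | a * triangle m + b * triangle l = n. j m * j l)"
  proof (rule sum.mono_neutral_cong_right)
    show "{(m, l). a * triangle m + b * triangle l = n} \<subseteq> {..N} \<times> {..N}"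
    proof clarsimp
      fix m l assume eq: "n = a * triangle m + b * triangle l"
      have le: "k \<le> c * triangle k" if "c > 0" for c k
      proof -
        have "k \<le> triangle k" by (induction k) auto
        also have "\<dots> \<le> c * triangle k" using that by simp
        finally show ?thesis .
      qed
      show "m \<le> N \<and> l \<le> N"
        using le[OF ab(1), of m] le[OF ab(2), of l] N(1) eq by linarith
    qed
  qed (auto split: if_splits)
  finally show ?thesis unfolding N(2) F_def j_def .
qed


section \<open>Representations by the form a u^2 + b v^2\<close>

text \<open>
  Besides the four points with $U, V = \pm 1$, the ellipse $aU^2 + bV^2 = a+b$ can contain integral
  points on the axes, such as $(\pm 2, 0)$ for $a = 1$, $b = 3$. The hypotheses rule these out:
  $U = 0$ gives $a = b(V^2-1)$, which is even for odd $V$, and $V = 0$ gives $b = a(U^2-1)$, which is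
  divisible by $8$ for odd $U$.
\<close>

lemma square_sum_eq_coeff_sum:
  fixes a b U V :: int
  assumes ab: "a > 0" "b > 0" and odd: "odd a" "\<not> 8 dvd b"
    and eq: "a * U ^ 2 + b * V ^ 2 = a + b"
    and par: "U = 0 \<Longrightarrow> odd V" "V = 0 \<Longrightarrow> odd U"
  shows "U ^ 2 = 1 \<and> V ^ 2 = 1"
proof -
  have odd_sq: "8 dvd w ^ 2 - 1" if w: "odd w" for w :: int
  proof -
    obtain k where k: "w = 2 * k + 1" using w by (auto elim: oddE)
    have "even (k * (k + 1))" by simp
    then obtain j where "k * (k + 1) = 2 * j" by (rule evenE)
    hence "w ^ 2 - 1 = 8 * j" unfolding k by (simp add: algebra_simps power2_eq_square)
    thus ?thesis by simp
  qed
  have "U \<noteq> 0"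
  proof
    assume U: "U = 0"
    have "a = b * (V ^ 2 - 1)" using eq U by (simp add: algebra_simps)
    moreover have "even (V ^ 2 - 1)" using par(1)[OF U] by simp
    ultimately show False using odd(1) by (metis even_mult_iff)
  qed
  moreover have "V \<noteq> 0"
  proof
    assume V: "V = 0"
    have "b = a * (U ^ 2 - 1)" using eq V by (simp add: algebra_simps)
    hence "8 dvd b" using odd_sq[OF par(2)[OF V]] by simp
    thus False using odd(2) by simp
  qed
  ultimately have "U ^ 2 \<ge> 1" "V ^ 2 \<ge> 1" by (simp_all add: int_one_le_iff_zero_less)
  hence "a * (U ^ 2 - 1) \<ge> 0" "b * (V ^ 2 - 1) \<ge> 0"
    using ab by (auto intro!: mult_nonneg_nonneg)
  moreover have "a * (U ^ 2 - 1) + b * (V ^ 2 - 1) = 0" using eq by (simp add: algebra_simps)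
  ultimately have "a * (U ^ 2 - 1) = 0" "b * (V ^ 2 - 1) = 0" by linarith+
  thus ?thesis using ab by simp
qed

text \<open>
  By the identity
  \[ a(ux+bvy)^2 + b(auy-xv)^2 = (au^2+bv^2)(x^2+aby^2) = (a+b)p^2, \]
  if $p$ divides $auy-xv$ then it divides $ux+bvy$ as well, and the quotients $V$ and $U$ lie on the
  ellipse $aU^2+bV^2=a+b$. The substitution is inverted by means of $x^2+aby^2=p$.
\<close>

lemma representation_step:
  fixes a b p x y u v :: int
  assumes a: "a > 0" and p: "prime p" "\<not> p dvd a" and px: "p = x ^ 2 + a * b * y ^ 2"
    and uv: "a * u ^ 2 + b * v ^ 2 = (a + b) * p" and d: "p dvd a * u * y - x * v"
  obtains U V where "u = x * U + b * y * V" "v = a * y * U - x * V" "a * U ^ 2 + b * V ^ 2 = a + b"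
proof -
  have p0: "p \<noteq> 0" using p(1) by auto
  obtain V where V: "a * u * y - x * v = p * V" using d by blast
  have id: "a * (u * x + b * v * y) ^ 2 + b * (a * u * y - x * v) ^ 2 = (a * u ^ 2 + b * v ^ 2) * (x ^ 2 + a * b * y ^ 2)"
    by (simp add: algebra_simps power2_eq_square)
  hence id': "a * (u * x + b * v * y) ^ 2 = p ^ 2 * ((a + b) - b * V ^ 2)"
    unfolding uv px[symmetric] V by (simp add: algebra_simps power2_eq_square)
  hence "p dvd a * (u * x + b * v * y) ^ 2" by (simp add: power2_eq_square)
  hence "p dvd u * x + b * v * y" using p by (metis prime_dvd_mult_iff prime_dvd_power)
  then obtain U where U: "u * x + b * v * y = p * U" by blast
  show thesis
  proof
    have "p * u = x * (u * x + b * v * y) + b * y * (a * u * y - x * v)"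
      unfolding px by (simp add: algebra_simps power2_eq_square)
    also have "\<dots> = p * (x * U + b * y * V)" unfolding U V by (simp add: algebra_simps)
    finally show "u = x * U + b * y * V" using p0 by simp
    have "p * v = a * y * (u * x + b * v * y) - x * (a * u * y - x * v)"
      unfolding px by (simp add: algebra_simps power2_eq_square)
    also have "\<dots> = p * (a * y * U - x * V)" unfolding U V by (simp add: algebra_simps)
    finally show "v = a * y * U - x * V" using p0 by simp
    have "p ^ 2 * (a * U ^ 2 + b * V ^ 2) = p ^ 2 * (a + b)"
      using id' unfolding U by (simp add: algebra_simps power2_eq_square)
    thus "a * U ^ 2 + b * V ^ 2 = a + b" using p0 by simp
  qed
qed

text \<open>
  Modulo $p$ one has $(auy)^2 \equiv (xv)^2$, because $x^2 \equiv -aby^2$ and $au^2 \equiv -bv^2$.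
  Hence $p$ divides $auy - xv$ up to the sign of $v$, and \<open>representation_step\<close> leaves only the
  points with $U, V = \pm 1$.
\<close>

lemma representation_unique:
  fixes a b p x y u v :: int
  assumes ab: "a > 0" "b > 0" "odd a" "\<not> 8 dvd b"
    and p: "prime p" "\<not> p dvd a" and px: "p = x ^ 2 + a * b * y ^ 2"
    and uv: "a * u ^ 2 + b * v ^ 2 = (a + b) * p" "odd u" "odd v"
  shows "(\<bar>u\<bar> = \<bar>x + b * y\<bar> \<and> \<bar>v\<bar> = \<bar>x - a * y\<bar>) \<or> (\<bar>u\<bar> = \<bar>x - b * y\<bar> \<and> \<bar>v\<bar> = \<bar>x + a * y\<bar>)"
proof -
  have main: "(\<bar>u\<bar> = \<bar>x + b * y\<bar> \<and> \<bar>v'\<bar> = \<bar>x - a * y\<bar>) \<or> (\<bar>u\<bar> = \<bar>x - b * y\<bar> \<and> \<bar>v'\<bar> = \<bar>x + a * y\<bar>)"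
    if v': "v' ^ 2 = v ^ 2" "odd v'" "p dvd a * u * y - x * v'" for v'
  proof -
    obtain U V where UV: "u = x * U + b * y * V" "v' = a * y * U - x * V" "a * U ^ 2 + b * V ^ 2 = a + b"
      using representation_step[OF ab(1) p px _ v'(3)] uv(1) v'(1) by metis
    have "U ^ 2 = 1 \<and> V ^ 2 = 1"
    proof (rule square_sum_eq_coeff_sum[OF ab UV(3)])
      show "odd V" if "U = 0" using v' that unfolding UV(2) by auto
      show "odd U" if "V = 0" using uv(2) that unfolding UV(1) by auto
    qed
    hence "U = 1 \<or> U = -1" "V = 1 \<or> V = -1" by (simp_all add: power2_eq_1_iff)
    thus ?thesis unfolding UV(1,2) by auto
  qed
  have "(a * u * y - x * v) * (a * u * y - x * (- v)) = a * y ^ 2 * (a * u ^ 2 + b * v ^ 2) - p * v ^ 2"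
    unfolding px by (simp add: algebra_simps power2_eq_square)
  hence "p dvd (a * u * y - x * v) * (a * u * y - x * (- v))"
    unfolding uv(1) by simp
  hence "p dvd a * u * y - x * v \<or> p dvd a * u * y - x * (- v)" using p(1) by (simp only: prime_dvd_mult_iff)
  thus ?thesis using main[of v] main[of "- v"] uv(3) by auto
qed

text \<open>
  For $|w| = 2m+1$ the Jacobi coefficient $(-1)^m(2m+1)$ is $w\chi(w)$, where $\chi$ is the character
  modulo $4$; it is invariant under $w \mapsto -w$. As $\chi$ is multiplicative, the coefficient of a
  product depends only on $uv$.
\<close>

lemma signed_odd_mult:
  fixes u v :: int
  assumes "odd u" "odd v"
  shows "(-1) ^ (nat \<bar>u\<bar> div 2) * \<bar>u\<bar> * ((-1) ^ (nat \<bar>v\<bar> div 2) * \<bar>v\<bar>)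
       = (if u * v mod 4 = 1 then u * v else - (u * v))"
proof -
  define sg where "sg = (\<lambda>w::int. if w mod 4 = 1 then 1 else -1 :: int)"
  have *: "(-1) ^ (nat \<bar>w\<bar> div 2) * \<bar>w\<bar> = sg w * w" if w: "odd w" for w :: int
  proof -
    have "even (nat \<bar>w\<bar> div 2) \<longleftrightarrow> (if w \<ge> 0 then w mod 4 = 1 else w mod 4 = 3)"
    proof (cases "w \<ge> 0")
      case True
      then obtain k where "w = int k" using nonneg_int_cases by blast
      thus ?thesis using w by simp presburger
    next
      case False
      then obtain k where "w = - int k" by (metis int_cases2 of_nat_0_le_iff)
      thus ?thesis using w False by simp presburger
    qed
    moreover have "w mod 4 = 1 \<or> w mod 4 = 3" using w by presburger
    ultimately show ?thesis by (auto simp: sg_def minus_one_power_iff)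
  qed
  have "u mod 4 = 1 \<or> u mod 4 = 3" "v mod 4 = 1 \<or> v mod 4 = 3" using assms by presburger+
  hence "sg u * sg v = sg (u * v)"
    by (auto simp: sg_def mod_mult_eq[of u 4 v, symmetric])
  thus ?thesis unfolding *[OF assms(1)] *[OF assms(2)] by (auto simp: sg_def algebra_simps)
qed


section \<open>Logarithmic derivatives and the sum over tuples\<close>

text \<open>
  \<open>R\<close> is the logarithmic derivative $X F'/F$, stated without division so that it makes sense for
  integer coefficients.
\<close>

definition log_deriv :: "'a::comm_ring_1 fps \<Rightarrow> 'a fps \<Rightarrow> bool" where
  "log_deriv F R \<longleftrightarrow> fps_X * fps_deriv F = R * F"

lemma log_deriv_mult: "log_deriv F R \<Longrightarrow> log_deriv G S \<Longrightarrow> log_deriv (F * G) (R + S)"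
proof -
  assume *: "log_deriv F R" "log_deriv G S"
  have "fps_X * fps_deriv (F * G) = F * (fps_X * fps_deriv G) + (fps_X * fps_deriv F) * G"
    by (simp add: distrib_left mult_ac)
  also have "\<dots> = (R + S) * (F * G)"
    using * unfolding log_deriv_def by (simp add: algebra_simps)
  finally show ?thesis unfolding log_deriv_def .
qed

lemma log_deriv_prod:
  "(\<And>i. i \<in> A \<Longrightarrow> log_deriv (F i) (R i)) \<Longrightarrow> log_deriv (prod F A) (sum R A)"
proof (induction A rule: infinite_finite_induct)
  case (insert i A)
  thus ?case by (simp add: log_deriv_mult)
qed (simp_all add: log_deriv_def)

lemma log_deriv_nth:
  assumes "log_deriv F R"
  shows "of_nat n * fps_nth F n = (\<Sum>k\<le>n. fps_nth R k * fps_nth F (n - k))"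
proof -
  have "of_nat n * fps_nth F n = fps_nth (fps_X * fps_deriv F) n"
    by (cases n) auto
  also have "\<dots> = (\<Sum>k\<le>n. fps_nth R k * fps_nth F (n - k))"
    using assms by (simp add: log_deriv_def fps_mult_nth atMost_atLeast0)
  finally show ?thesis .
qed

lemma fps_nth_prod_0: "fps_nth (prod F A) 0 = (\<Prod>i\<in>A. fps_nth (F i) 0)"
  by (induction A rule: infinite_finite_induct) auto

text \<open>
  The recurrence of \<open>log_deriv_nth\<close> determines a series by its constant term and its logarithmic
  derivative, even when the latter is known only up to a given index. It is phrased for sequences
  because the two series to be compared have coefficients in different rings.
\<close>

lemma log_deriv_recurrence_unique:
  fixes f g r :: "nat \<Rightarrow> 'a::{idom,ring_char_0}"
  assumes f: "\<And>n. n \<le> N \<Longrightarrow> of_nat n * f n = (\<Sum>k\<le>n. r k * f (n - k))"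
    and g: "\<And>n. n \<le> N \<Longrightarrow> of_nat n * g n = (\<Sum>k\<le>n. r k * g (n - k))"
    and r0: "r 0 = 0" and eq0: "f 0 = g 0" and "n \<le> N"
  shows "f n = g n"
  using \<open>n \<le> N\<close>
proof (induction n rule: less_induct)
  case (less n)
  show ?case
  proof (cases "n = 0")
    case False
    have "r k * f (n - k) = r k * g (n - k)" if "k \<le> n" for k
      using less that False r0 by (cases "k = 0") auto
    hence "(\<Sum>k\<le>n. r k * f (n - k)) = (\<Sum>k\<le>n. r k * g (n - k))" by (intro sum.cong) auto
    hence "of_nat n * f n = of_nat n * g n"
      using f[OF less.prems] g[OF less.prems] by simp
    thus ?thesis using False by simp
  qed (simp add: eq0)
qed

text \<open>
  The expansion $-mX^m/(1-X^m) = -m\sum_{j \ge 1} X^{mj}$.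
\<close>

lemma log_deriv_one_minus_power:
  fixes m :: nat
  assumes "m > 0"
  shows "log_deriv (1 - fps_X ^ m :: 'a::comm_ring_1 fps)
           (Abs_fps (\<lambda>k. if k > 0 \<and> m dvd k then - of_nat m else 0))"
  unfolding log_deriv_def
proof (rule fps_ext)
  fix n
  let ?R = "Abs_fps (\<lambda>k. if k > 0 \<and> m dvd k then - of_nat m else 0) :: 'a fps"
  have "fps_nth (fps_X * fps_deriv (1 - fps_X ^ m :: 'a fps)) n = (if n = m then - of_nat m else 0)"
    using assms by (cases n) (auto simp: fps_X_power_nth)
  moreover have "fps_nth (?R * (1 - fps_X ^ m)) n = (if n = m then - of_nat m else 0)"
    using assms by (auto simp: right_diff_distrib fps_X_power_mult_right_nth dvd_minus_self not_less)
  ultimately show "fps_nth (fps_X * fps_deriv (1 - fps_X ^ m :: 'a fps)) n = fps_nth (?R * (1 - fps_X ^ m)) n"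
    by simp
qed

text \<open>
  The coefficients of $\exp(tX^i)$.
\<close>

definition exp_monom :: "nat \<Rightarrow> 'a::field_char_0 \<Rightarrow> 'a fps" where
  "exp_monom i t = Abs_fps (\<lambda>k. if i dvd k then t ^ (k div i) / fact (k div i) else 0)"

lemma log_deriv_exp_monom:
  assumes "i > 0"
  shows "log_deriv (exp_monom i t) (fps_const (of_nat i * t) * fps_X ^ i)"
  unfolding log_deriv_def
proof (rule fps_ext)
  fix n
  have "of_nat n * fps_nth (exp_monom i t) n =
      (if n < i then 0 else of_nat i * t * fps_nth (exp_monom i t) (n - i))"
  proof (cases "i dvd n")
    case False
    thus ?thesis by (auto simp: exp_monom_def dvd_minus_self)
  next
    case True
    then obtain k where k: "n = i * k" by blast
    show ?thesis
    proof (cases k)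
      case (Suc j)
      have "of_nat (Suc j) \<noteq> (0 :: 'a)" by (simp only: of_nat_eq_0_iff)
      hence "of_nat i * of_nat (Suc j) * (t ^ Suc j / fact (Suc j)) = of_nat i * t * (t ^ j / fact j)"
        unfolding fact_Suc by (simp add: divide_simps del: of_nat_Suc)
      moreover have "n - i = i * j" "\<not> n < i" using k Suc by simp_all
      ultimately show ?thesis using k Suc assms
        by (simp add: exp_monom_def del: of_nat_Suc mult_Suc_right fact_Suc power_Suc)
    qed (use k assms in auto)
  qed
  moreover have "fps_nth (fps_X * fps_deriv (exp_monom i t)) n = of_nat n * fps_nth (exp_monom i t) n"
    by (cases n) auto
  ultimately show "fps_nth (fps_X * fps_deriv (exp_monom i t)) n =
      fps_nth (fps_const (of_nat i * t) * fps_X ^ i * exp_monom i t) n"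
    by (simp add: mult.assoc fps_X_power_mult_nth)
qed

lemma exp_monom_trunc:
  assumes "i > 0"
  shows "fps_X ^ Suc n dvd exp_monom i t - (\<Sum>j\<le>n. fps_const (t ^ j / fact j) * fps_X ^ (i * j))"
proof -
  have "fps_nth (\<Sum>j\<le>n. fps_const (t ^ j / fact j) * fps_X ^ (i * j)) k = fps_nth (exp_monom i t) k"
    if "k \<le> n" for k
  proof -
    have "fps_nth (\<Sum>j\<le>n. fps_const (t ^ j / fact j) * fps_X ^ (i * j)) k
       = (\<Sum>j\<le>n. if i * j = k then t ^ j / fact j else 0)"
      by (auto simp: fps_sum_nth fps_X_power_nth intro!: sum.cong)
    also have "\<dots> = fps_nth (exp_monom i t) k"
    proof (cases "i dvd k")
      case True
      then obtain j0 where j0: "k = i * j0" by blast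
      have "j0 \<le> n" using j0 that assms
        by (metis One_nat_def Suc_leI le_trans mult_le_mono1 nat_mult_1)
      thus ?thesis using j0 assms by (simp add: exp_monom_def)
    next
      case False
      hence "i * j \<noteq> k" for j by auto
      thus ?thesis using False by (simp add: exp_monom_def)
    qed
    finally show ?thesis .
  qed
  thus ?thesis unfolding fps_X_power_dvd_iff by simp
qed

lemma fps_const_prod: "fps_const (prod f A) = (\<Prod>i\<in>A. fps_const (f i :: 'a::comm_ring_1))"
  by (induction A rule: infinite_finite_induct) (auto simp flip: fps_const_mult)

text \<open>
  A tuple $(k_1,\ldots,k_n)$ selects the term $t_i^{k_i}X^{ik_i}/k_i!$ from each exponential
  $\exp(t_iX^i)$. The exponentials are first truncated, so that expanding the product gives a finite
  sum over choice functions.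
\<close>

lemma prod_exp_monom_nth:
  "fps_nth (\<Prod>i=1..n. exp_monom i (t i)) n =
     (\<Sum>k\<in>weighted_tuples n. \<Prod>i=1..n. t i ^ k i / fact (k i))"
proof -
  let ?E = "\<lambda>i. \<Sum>j\<le>n. fps_const (t i ^ j / fact j) * fps_X ^ (i * j)"
  have "fps_X ^ Suc n dvd (\<Prod>i=1..n. exp_monom i (t i)) - (\<Prod>i=1..n. ?E i)"
    by (intro prod_congruent_dvd exp_monom_trunc) auto
  hence "fps_nth (\<Prod>i=1..n. exp_monom i (t i)) n = fps_nth (\<Prod>i=1..n. ?E i) n"
    unfolding fps_X_power_dvd_iff by simp
  also have "(\<Prod>i=1..n. ?E i) =
      (\<Sum>k\<in>PiE {1..n} (\<lambda>_. {..n}). \<Prod>i=1..n. fps_const (t i ^ k i / fact (k i)) * fps_X ^ (i * k i))"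
    by (rule prod_sum_PiE) auto
  also have "\<dots> = (\<Sum>k\<in>PiE {1..n} (\<lambda>_. {..n}).
      fps_const (\<Prod>i=1..n. t i ^ k i / fact (k i)) * fps_X ^ (\<Sum>i=1..n. i * k i))"
    by (simp add: prod.distrib fps_const_prod power_sum)
  also have "fps_nth \<dots> n = (\<Sum>k\<in>PiE {1..n} (\<lambda>_. {..n}).
      if (\<Sum>i=1..n. i * k i) = n then \<Prod>i=1..n. t i ^ k i / fact (k i) else 0)"
    by (auto simp: fps_sum_nth fps_X_power_nth intro!: sum.cong)
  also have "\<dots> = (\<Sum>k\<in>weighted_tuples n. \<Prod>i=1..n. t i ^ k i / fact (k i))"
  proof (rule sum.mono_neutral_cong_right)
    have le: "k i \<le> n" if k: "k \<in> weighted_tuples n" and i: "i \<in> {1..n}" for k i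
    proof -
      have "k i \<le> i * k i" using i by simp
      also have "\<dots> \<le> (\<Sum>i=1..n. i * k i)" by (rule member_le_sum) (use i in auto)
      finally show ?thesis using k by (simp add: weighted_tuples_def)
    qed
    show "weighted_tuples n \<subseteq> PiE {1..n} (\<lambda>_. {..n})"
    proof
      fix k assume k: "k \<in> weighted_tuples n"
      show "k \<in> PiE {1..n} (\<lambda>_. {..n})"
        using le[OF k] k by (simp add: PiE_iff weighted_tuples_def)
    qed
  qed (auto simp: weighted_tuples_def intro!: finite_PiE)
  finally show ?thesis .
qed

lemma sigma_of_nat_div:
  assumes "a > 0" "n > 0"
  shows "sigma (of_nat n / of_nat a) = (if a dvd n then \<Sum>{d. d dvd n div a} else 0)"
proof (cases "a dvd n")
  case True
  then obtain m where m: "n = a * m" by blast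
  have "of_nat n / of_nat a = (of_nat m :: rat)" using m assms by simp
  thus ?thesis using m assms by (simp add: sigma_def)
next
  case False
  have "(of_nat n / of_nat a :: rat) \<notin> \<int>"
  proof
    assume "(of_nat n / of_nat a :: rat) \<in> \<int>"
    then obtain z where "(of_nat n / of_nat a :: rat) = of_int z" by (auto elim: Ints_cases)
    hence "(of_nat n :: rat) = of_int z * of_nat a" using assms by (simp add: field_simps)
    hence "(of_int (int n) :: rat) = of_int (z * int a)" by simp
    hence "int n = z * int a" unfolding of_int_eq_iff .
    thus False using False by (metis dvd_triv_right int_dvd_int_iff)
  qed
  thus ?thesis using False by (simp add: sigma_def)
qed

text \<open>
  Summing $-am\sum_{j\ge1} X^{amj}$ over $m$ collects at $X^k$ the terms $-am$ with $am \mid k$,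
  which is $-a\,\sigma(k/a)$. With $N$ factors this is complete for $k \le N$, since $am \mid k$ forces
  $m \le N$.
\<close>

lemma log_deriv_qpoch:
  assumes "a > 0"
  obtains R where "log_deriv (qpoch (fps_X ^ a) N :: int fps) R" "fps_nth R 0 = 0"
    "\<And>k. 0 < k \<Longrightarrow> k \<le> N \<Longrightarrow> fps_nth R k = - int (a * sigma (of_nat k / of_nat a))"
proof
  define r where "r = (\<lambda>i. Abs_fps (\<lambda>k. if k > 0 \<and> a * Suc i dvd k then - of_nat (a * Suc i) else 0) :: int fps)"
  show "log_deriv (qpoch (fps_X ^ a) N :: int fps) (\<Sum>i<N. r i)"
    unfolding qpoch_def power_mult[symmetric] r_def
    by (intro log_deriv_prod log_deriv_one_minus_power) (use assms in simp)
  show "fps_nth (\<Sum>i<N. r i) 0 = 0" by (simp add: fps_sum_nth r_def)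
  fix k :: nat assume k: "0 < k" "k \<le> N"
  have "fps_nth (\<Sum>i<N. r i) k = - (\<Sum>i<N. if a * Suc i dvd k then int (a * Suc i) else 0)"
    using k by (auto simp: fps_sum_nth r_def sum_negf[symmetric] intro!: sum.cong)
  also have "(\<Sum>i<N. if a * Suc i dvd k then int (a * Suc i) else 0)
      = (\<Sum>d\<in>{1..N}. if a * d dvd k then int (a * d) else 0)"
    by (rule sum.reindex_bij_witness[of _ "\<lambda>d. d - 1" Suc]) auto
  also have "\<dots> = int a * (\<Sum>d\<in>{d\<in>{1..N}. a * d dvd k}. int d)"
    by (simp add: sum.inter_filter[symmetric] sum_distrib_left)
  also have "(\<Sum>d\<in>{d\<in>{1..N}. a * d dvd k}. int d) = int (sigma (of_nat k / of_nat a))"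
  proof (cases "a dvd k")
    case False
    hence "{d\<in>{1..N}. a * d dvd k} = {}" using dvd_mult_left by blast
    moreover have "sigma (of_nat k / of_nat a) = 0" using False assms k by (simp add: sigma_of_nat_div)
    ultimately show ?thesis by (simp only: sum.empty of_nat_0)
  next
    case True
    then obtain m where m: "k = a * m" by blast
    have "d \<le> N" if "d dvd m" for d
    proof -
      have "d \<le> m" using that k m by (auto intro: dvd_imp_le)
      also have "m \<le> k" using m assms by simp
      finally show ?thesis using k by simp
    qed
    hence "{d\<in>{1..N}. a * d dvd k} = {d. d dvd m}"
      using m assms k by (auto intro!: Suc_leI intro: dvd_pos_nat)
    moreover have "sigma (of_nat k / of_nat a) = \<Sum>{d. d dvd m}"
      unfolding sigma_of_nat_div[OF assms k(1)] using True m assms by simp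
    ultimately show ?thesis by (simp only: of_nat_sum)
  qed
  finally show "fps_nth (\<Sum>i<N. r i) k = - int (a * sigma (of_nat k / of_nat a))" by simp
qed

text \<open>
  Both sides are $n$-th coefficients of series with constant term $1$ whose logarithmic derivatives
  agree up to index $n$: the product itself, and $\prod_{i \le n} \exp(-3 s_i X^i/i)$ with
  $s_i = a\,\sigma(i/a) + b\,\sigma(i/b)$.
\<close>

theorem lam_eq_sigma_sum:
  assumes ab: "a > 0" "b > 0"
  shows "of_int (lam a b (n + 1)) = sigma_sum a b n"
proof -
  obtain N where N: "n \<le> N"
    "lam a b (n + 1) = fps_nth (qpoch (fps_X ^ a) N ^ 3 * qpoch (fps_X ^ b) N ^ 3) n"
    using lam_eq_coeff[OF ab] by blast
  define F :: "int fps" where "F = qpoch (fps_X ^ a) N ^ 3 * qpoch (fps_X ^ b) N ^ 3"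
  define s where "s = (\<lambda>k. of_nat a * of_nat (sigma (of_nat k / of_nat a))
                         + of_nat b * of_nat (sigma (of_nat k / of_nat b)) :: rat)"
  obtain Ra where Ra: "log_deriv (qpoch (fps_X ^ a) N :: int fps) Ra" "fps_nth Ra 0 = 0"
    "\<And>k. 0 < k \<Longrightarrow> k \<le> N \<Longrightarrow> fps_nth Ra k = - int (a * sigma (of_nat k / of_nat a))"
    using log_deriv_qpoch[OF ab(1)] by blast
  obtain Rb where Rb: "log_deriv (qpoch (fps_X ^ b) N :: int fps) Rb" "fps_nth Rb 0 = 0"
    "\<And>k. 0 < k \<Longrightarrow> k \<le> N \<Longrightarrow> fps_nth Rb k = - int (b * sigma (of_nat k / of_nat b))"
    using log_deriv_qpoch[OF ab(2)] by blast
  define R where "R = (Ra + Ra + Ra) + (Rb + Rb + Rb)"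
  have "log_deriv F R" unfolding F_def R_def power3_eq_cube
    by (intro log_deriv_mult Ra Rb)
  define r where "r = (\<lambda>k. of_int (fps_nth R k) :: rat)"
  have r: "r 0 = 0" "\<And>k. 0 < k \<Longrightarrow> k \<le> N \<Longrightarrow> r k = - 3 * s k"
    by (simp_all add: r_def R_def Ra Rb s_def)
  define t where "t = (\<lambda>i. - 3 * s i / of_nat i)"
  have t_pow: "t i ^ j / fact j = (-3) ^ j * (s i ^ j / (of_nat i ^ j * fact j))" for i j
  proof -
    have "t i = (-3) * (s i / of_nat i)" by (simp add: t_def)
    thus ?thesis by (simp only: power_mult_distrib power_divide) simp
  qed
  define G where "G = (\<Prod>i=1..n. exp_monom i (t i))"
  define S where "S = (\<Sum>i=1..n. fps_const (of_nat i * t i) * fps_X ^ i)"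
  have GS: "log_deriv G S" unfolding G_def S_def
    by (intro log_deriv_prod log_deriv_exp_monom) auto
  have S: "fps_nth S k = r k" if "k \<le> n" for k
  proof -
    have "fps_nth S k = (\<Sum>i=1..n. if i = k then of_nat i * t i else 0)"
      unfolding S_def fps_sum_nth by (intro sum.cong) auto
    thus ?thesis using that N r by (cases "k = 0") (auto simp: t_def sum.delta)
  qed
  have "of_int (fps_nth F n) = fps_nth G n"
  proof (rule log_deriv_recurrence_unique[where r = r and N = n])
    fix m assume m: "m \<le> n"
    have "of_int (int m * fps_nth F m) = (of_int (\<Sum>k\<le>m. fps_nth R k * fps_nth F (m - k)) :: rat)"
      using log_deriv_nth[OF \<open>log_deriv F R\<close>, of m] by simp
    thus "of_nat m * of_int (fps_nth F m) = (\<Sum>k\<le>m. r k * of_int (fps_nth F (m - k)))"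
      by (simp add: r_def)
    show "of_nat m * fps_nth G m = (\<Sum>k\<le>m. r k * fps_nth G (m - k))"
      using log_deriv_nth[OF GS, of m] m S by simp
  next
    have q0: "fps_nth (qpoch (fps_X ^ c) N :: int fps) 0 = 1" if "c > 0" for c
      using that by (simp add: qpoch_def fps_nth_prod_0 fps_nth_power_0 power_0_left)
    have "fps_nth F 0 = 1" using ab by (simp add: F_def fps_nth_power_0 q0)
    moreover have "fps_nth G 0 = 1" by (simp add: G_def exp_monom_def fps_nth_prod_0)
    ultimately show "of_int (fps_nth F 0) = fps_nth G 0" by simp
  qed (simp_all add: r)
  also have "fps_nth G n = (\<Sum>k\<in>weighted_tuples n. \<Prod>i=1..n. t i ^ k i / fact (k i))"
    unfolding G_def by (rule prod_exp_monom_nth)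
  also have "\<dots> = sigma_sum a b n"
    unfolding sigma_sum_def t_pow prod.distrib prod_dividef power_sum s_def ..
  finally show ?thesis using N by (simp add: F_def)
qed


section \<open>The value at a represented prime\<close>

text \<open>
  Multiplying $a\,m(m+1)/2 + b\,l(l+1)/2 = n$ by $8$ and completing squares turns the index set of
  \<open>lam_eq_double_sum\<close> into the positive odd solutions of $au^2+bv^2 = (a+b)p$, which are
  $(|x \pm by|, |x \mp ay|)$. They are distinct as $xy \ne 0$, and their contributions carry the same
  sign, so the sum is $\pm\bigl((x+by)(x-ay) + (x-by)(x+ay)\bigr) = \pm 2(x^2-aby^2) = \pm(4x^2-2p)$.
\<close>

lemma lam_eq_of_representation:
  fixes a b p n :: nat and x y r :: int
  assumes ab: "a > 0" "b > 0" "odd a" "\<not> 8 dvd b" and p: "prime p"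
    and px: "int p = x ^ 2 + int a * int b * y ^ 2" and xy: "x \<noteq> 0" "y \<noteq> 0"
    and n: "8 * n = (a + b) * (p - 1)"
    and odd: "odd (x + int b * y)" "odd (x - int a * y)"
    and r: "(x + int b * y) * (x - int a * y) mod 4 = r" "(x - int b * y) * (x + int a * y) mod 4 = r"
  shows "lam a b (n + 1) = (if r = 1 then 1 else -1) * (4 * x ^ 2 - 2 * int p)"
proof -
  define A B P where "A = int a" and "B = int b" and "P = int p"
  note ABP = A_def[symmetric] B_def[symmetric] P_def[symmetric]
  define h where "h = (\<lambda>w::int. nat \<bar>w\<bar> div 2)"
  have h: "2 * int (h w) + 1 = \<bar>w\<bar>" if w: "odd w" for w
  proof -
    obtain k where k: "\<bar>w\<bar> = int k" using nonneg_int_cases[of "\<bar>w\<bar>"] by auto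
    hence "odd k" using w by (metis dvd_abs_iff even_of_nat)
    thus ?thesis unfolding h_def k by simp presburger
  qed
  have tri: "8 * int (triangle m) + 1 = (2 * int m + 1) ^ 2" for m
    by (induction m) (simp_all add: power2_eq_square algebra_simps)
  have "p \<ge> 1" using p prime_ge_1_nat by blast
  hence "8 * int n = (A + B) * (P - 1)"
    using arg_cong[OF n, of int] by (simp add: A_def B_def P_def of_nat_diff)
  hence S_iff: "a * triangle m + b * triangle l = n \<longleftrightarrow>
      A * (2 * int m + 1) ^ 2 + B * (2 * int l + 1) ^ 2 = (A + B) * P" for m l
  proof -
    assume n: "8 * int n = (A + B) * (P - 1)"
    have "a * triangle m + b * triangle l = n \<longleftrightarrow> int (a * triangle m + b * triangle l) = int n"
      by (simp only: of_nat_eq_iff)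
    also have "\<dots> \<longleftrightarrow> 8 * (A * int (triangle m) + B * int (triangle l)) = 8 * int n"
      by (subst mult_cancel_left) (simp add: A_def B_def)
    also have "\<dots> \<longleftrightarrow> A * (8 * int (triangle m) + 1) + B * (8 * int (triangle l) + 1) = (A + B) * P"
      unfolding n by (simp add: algebra_simps)
    finally show ?thesis unfolding tri .
  qed
  define u1 v1 u2 v2 where uv: "u1 = x + B * y" "v1 = x - A * y" "u2 = x - B * y" "v2 = x + A * y"
  have odds: "odd u1" "odd v1" "odd u2" "odd v2"
    using odd unfolding uv ABP by auto
  have px': "P = x ^ 2 + A * B * y ^ 2" using px by (simp only: ABP)
  have AB: "A > 0" "B > 0" using ab by (simp_all add: A_def B_def)
  \<comment> \<open>As \<open>x\<close> and \<open>y\<close> are nonzero, \<open>P\<close> exceeds \<open>A * B\<close>.\<close>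
  have "\<not> P dvd A"
  proof
    assume "P dvd A"
    hence "P \<le> A" using AB by (simp add: zdvd_imp_le)
    moreover have "A * 1 \<le> A * (B * y ^ 2)"
    proof (rule mult_left_mono)
      have "0 < B * y ^ 2" using AB xy by simp
      thus "1 \<le> B * y ^ 2" by linarith
    qed (use AB in simp)
    moreover have "x ^ 2 > 0" using xy by simp
    ultimately show False unfolding px' by (simp add: mult.assoc)
  qed
  note unique = representation_unique[OF AB _ _ _ this px']
  have set_eq: "{(m, l). a * triangle m + b * triangle l = n} = {(h u1, h v1), (h u2, h v2)}"
  proof (intro equalityI subsetI)
    fix z assume "z \<in> {(m, l). a * triangle m + b * triangle l = n}"
    then obtain m l where z: "z = (m, l)" "a * triangle m + b * triangle l = n" by blast
    define u v where "u = 2 * int m + 1" and "v = 2 * int l + 1"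
    have "(\<bar>u\<bar> = \<bar>u1\<bar> \<and> \<bar>v\<bar> = \<bar>v1\<bar>) \<or> (\<bar>u\<bar> = \<bar>u2\<bar> \<and> \<bar>v\<bar> = \<bar>v2\<bar>)"
      unfolding uv
    proof (rule unique)
      show "odd A" "\<not> 8 dvd B" using ab by (simp_all add: A_def B_def) presburger
      show "prime P" using p by (simp add: P_def)
      show "A * u ^ 2 + B * v ^ 2 = (A + B) * P" using z(2) unfolding S_iff u_def v_def .
    qed (simp_all add: u_def v_def)
    moreover have "h u = m" "h v = l" by (simp_all add: h_def u_def v_def nat_add_distrib nat_mult_distrib)
    ultimately show "z \<in> {(h u1, h v1), (h u2, h v2)}"
      unfolding z h_def by auto
  next
    fix z assume "z \<in> {(h u1, h v1), (h u2, h v2)}"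
    moreover have "a * triangle (h u1) + b * triangle (h v1) = n" "a * triangle (h u2) + b * triangle (h v2) = n"
      unfolding S_iff h[OF odds(1)] h[OF odds(2)] h[OF odds(3)] h[OF odds(4)] power2_abs
      unfolding uv px' by (simp_all add: algebra_simps power2_eq_square)
    ultimately show "z \<in> {(m, l). a * triangle m + b * triangle l = n}" by auto
  qed
  have "\<bar>u1\<bar> \<noteq> \<bar>u2\<bar>" using xy AB by (auto simp: uv abs_if)
  hence ne: "(h u1, h v1) \<noteq> (h u2, h v2)" using h[OF odds(1)] h[OF odds(3)] by auto
  have contribution: "(-1) ^ h u * int (2 * h u + 1) * ((-1) ^ h v * int (2 * h v + 1))
      = (if u * v mod 4 = 1 then u * v else - (u * v))" if "odd u" "odd v" for u v
  proof -
    have "int (2 * h u + 1) = \<bar>u\<bar>" "int (2 * h v + 1) = \<bar>v\<bar>"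
      using h[OF that(1)] h[OF that(2)] by simp_all
    thus ?thesis unfolding h_def using signed_odd_mult[OF that] by (simp only:)
  qed
  have "lam a b (n + 1) = (if u1 * v1 mod 4 = 1 then u1 * v1 else - (u1 * v1))
      + (if u2 * v2 mod 4 = 1 then u2 * v2 else - (u2 * v2))"
    unfolding lam_eq_double_sum[OF ab(1,2)] set_eq using ne
    by (simp only: sum.insert finite.emptyI finite.insertI insert_iff empty_iff simp_thms
        sum.empty add_0_right prod.case contribution odds)
  also have "\<dots> = (if r = 1 then 1 else -1) * (u1 * v1 + u2 * v2)"
    using r unfolding uv ABP by simp
  also have "u1 * v1 + u2 * v2 = 4 * x ^ 2 - 2 * P"
    unfolding uv px' by (simp add: algebra_simps power2_eq_square)
  finally show ?thesis unfolding P_def .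
qed

lemma powi_minus_one: "(-1 :: 'a::field) powi k = (if even k then 1 else -1)"
  by (simp add: power_int_minus_left)

text \<open>
  The cross term $(B-A)xy$ vanishes modulo $4$, because $B-A$ and $xy$ are even; this leaves
  $x^2 - ABy^2$, where one square is $1$ and the other $0$ modulo $4$.
\<close>

lemma product_mod_4_odd_odd:
  fixes A B x y :: int
  assumes "odd A" "odd B" "odd x \<longleftrightarrow> even y"
  shows "(x + B * y) * (x - A * y) mod 4 = (if even ((A * B + 1) div 2 * y) then 1 else 3)"
proof -
  have "even (B - A)" using assms by simp
  then obtain d where d: "B - A = 2 * d" by (rule evenE)
  have expand: "(x + B * y) * (x - A * y) = x ^ 2 + 2 * d * x * y - A * B * y ^ 2"
    unfolding d[symmetric] by (simp add: algebra_simps power2_eq_square)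
  show ?thesis
  proof (cases "even y")
    case True
    then obtain k z where kz: "x = 2 * k + 1" "y = 2 * z" using assms by (auto elim!: oddE evenE)
    have "(x + B * y) * (x - A * y) = 1 + 4 * (k ^ 2 + k + d * x * z - A * B * z ^ 2)"
      unfolding expand unfolding kz by (simp add: algebra_simps power2_eq_square)
    thus ?thesis using True by (simp only: mod_mult_self2) simp
  next
    case False
    then obtain k z where kz: "x = 2 * k" "y = 2 * z + 1" using assms by (auto elim!: oddE evenE)
    have "(x + B * y) * (x - A * y) = - (A * B) + 4 * (k ^ 2 + d * k * y - A * B * (z ^ 2 + z))"
      unfolding expand unfolding kz by (simp add: algebra_simps power2_eq_square)
    hence "(x + B * y) * (x - A * y) mod 4 = - (A * B) mod 4" by (simp only: mod_mult_self2)
    moreover have "- C mod 4 = (if even ((C + 1) div 2) then 1 else 3)" if "odd C" for C :: int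
      using that by presburger
    hence "- (A * B) mod 4 = (if even ((A * B + 1) div 2) then 1 else 3)" using assms by simp
    ultimately show ?thesis using False by simp
  qed
qed

text \<open>
  Here $ABy^2$ vanishes modulo $4$, while the cross term $(B-A)xy$ is an odd multiple of the even
  number $y$ and hence congruent to $y$.
\<close>

lemma product_mod_4_odd_even:
  fixes A B x y :: int
  assumes "odd A" "even B" "odd x" "even y"
  shows "(x + B * y) * (x - A * y) mod 4 = (if even (y div 2) then 1 else 3)"
proof -
  obtain k where k: "x = 2 * k + 1" using assms by (auto elim: oddE)
  obtain z where z: "y = 2 * z" using assms by (auto elim: evenE)
  have "odd ((B - A) * x)" using assms by simp
  then obtain c where c: "(B - A) * x = 2 * c + 1" by (rule oddE)
  have "(x + B * y) * (x - A * y) = x ^ 2 + 2 * z * ((B - A) * x) - 4 * A * B * z ^ 2"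
    unfolding z by (simp add: algebra_simps power2_eq_square)
  also have "\<dots> = (1 + 2 * z) + 4 * (k ^ 2 + k + z * c - A * B * z ^ 2)"
    unfolding c unfolding k by (simp add: algebra_simps power2_eq_square)
  finally have "(x + B * y) * (x - A * y) mod 4 = (1 + 2 * z) mod 4" by (simp only: mod_mult_self2)
  also have "\<dots> = (if even z then 1 else 3)" by presburger
  finally show ?thesis unfolding z by simp
qed

theorem theorem3p2:
  fixes a b p n :: nat and x y :: int
  assumes "a > 0" and "b > 0" and "coprime a b"
    and "prime p" and "odd p" and "p \<noteq> a * b" and "p \<noteq> a * b + 1"
    and "int p = x ^ 2 + int a * int b * y ^ 2"
    and "n = (a + b) * (p - 1) div 8"
  shows "(odd (a * b) \<longrightarrow>
            (-1) powi (int ((a * b + 1) div 2) * y) * of_int (4 * x ^ 2 - 2 * int p)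
              = (of_int (lam a b (n + 1)) :: rat) \<and>
            of_int (lam a b (n + 1)) = sigma_sum a b n) \<and>
         (odd a \<and> even b \<and> \<not> 8 dvd b \<and> 8 dvd (p - 1) \<longrightarrow>
            (-1) powi (y div 2) * of_int (4 * x ^ 2 - 2 * int p)
              = (of_int (lam a b (n + 1)) :: rat) \<and>
            of_int (lam a b (n + 1)) = sigma_sum a b n)"
proof -
  define A B where AB: "A = int a" "B = int b"
  have px: "int p = x ^ 2 + A * B * y ^ 2" using assms(8) by (simp add: AB)
  have sq: "\<not> prime (Y * Y)" for Y :: nat
    using prime_product[of Y Y] by auto
  have "y \<noteq> 0"
  proof
    assume "y = 0"
    hence "int p = int (nat \<bar>x\<bar> * nat \<bar>x\<bar>)" using px by (simp add: power2_eq_square)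
    hence "p = nat \<bar>x\<bar> * nat \<bar>x\<bar>" by (simp only: of_nat_eq_iff)
    thus False using assms(4) sq by metis
  qed
  \<comment> \<open>If \<open>x = 0\<close>, then \<open>p\<close> is \<open>a * b\<close> times a square; this is where \<open>p \<noteq> a * b\<close> enters.\<close>
  have "x \<noteq> 0"
  proof
    assume "x = 0"
    hence "int p = int (a * b * (nat \<bar>y\<bar> * nat \<bar>y\<bar>))" using px by (simp add: power2_eq_square AB)
    hence p: "p = a * b * (nat \<bar>y\<bar> * nat \<bar>y\<bar>)" by (simp only: of_nat_eq_iff)
    hence "a * b = 1 \<or> nat \<bar>y\<bar> * nat \<bar>y\<bar> = 1" using assms(4) prime_product by metis
    thus False
    proof
      assume "a * b = 1"
      thus False using p assms(4) sq by (metis nat_mult_1)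
    next
      assume "nat \<bar>y\<bar> * nat \<bar>y\<bar> = 1"
      thus False using p assms(6) by simp
    qed
  qed
  note coeff = lam_eq_of_representation[OF assms(1,2) _ _ assms(4,8) \<open>x \<noteq> 0\<close> \<open>y \<noteq> 0\<close>, folded AB]
  have sigma: "of_int (lam a b (n + 1)) = sigma_sum a b n" by (rule lam_eq_sigma_sum[OF assms(1,2)])
  have odd_p: "odd (x ^ 2 + A * B * y ^ 2)" using assms(5) unfolding px[symmetric] by simp
  have i: "(-1) powi (int ((a * b + 1) div 2) * y) * of_int (4 * x ^ 2 - 2 * int p)
              = (of_int (lam a b (n + 1)) :: rat)" if ab: "odd (a * b)"
  proof -
    have oAB: "odd A" "odd B" using ab by (simp_all add: AB)
    have xy: "odd x \<longleftrightarrow> even y" using odd_p oAB by auto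
    define r :: int where "r = (if even (int ((a * b + 1) div 2) * y) then 1 else 3)"
    have half: "int ((a * b + 1) div 2) = (A * B + 1) div 2" by (simp add: AB zdiv_int)
    have "lam a b (n + 1) = (if r = 1 then 1 else -1) * (4 * x ^ 2 - 2 * int p)"
    proof (rule coeff)
      show "odd a" "\<not> 8 dvd b" using ab by auto
      show "8 * n = (a + b) * (p - 1)"
        using eight_dvd_odd_case[OF ab assms(5,8)] assms(9) by simp
      show "odd (x + B * y)" "odd (x - A * y)" using xy oAB by auto
      show "(x + B * y) * (x - A * y) mod 4 = r"
        unfolding product_mod_4_odd_odd[OF oAB xy] r_def half ..
      \<comment> \<open>The second product arises from the first by changing the sign of \<open>y\<close>.\<close>
      show "(x - B * y) * (x + A * y) mod 4 = r"
        using product_mod_4_odd_odd[OF oAB, of x "- y"] xy unfolding r_def half by simp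
    qed
    thus ?thesis unfolding powi_minus_one r_def by simp
  qed
  have ii: "(-1) powi (y div 2) * of_int (4 * x ^ 2 - 2 * int p) = (of_int (lam a b (n + 1)) :: rat)"
    if ab: "odd a" "even b" "\<not> 8 dvd b" "8 dvd (p - 1)"
  proof -
    have AB': "odd A" "even B" using ab by (simp_all add: AB)
    have y: "even y" by (rule even_y_even_case[OF ab(1-3) assms(5) ab(4) assms(8)])
    have x: "odd x" using odd_p AB' by auto
    define r :: int where "r = (if even (y div 2) then 1 else 3)"
    have "lam a b (n + 1) = (if r = 1 then 1 else -1) * (4 * x ^ 2 - 2 * int p)"
    proof (rule coeff)
      show "8 * n = (a + b) * (p - 1)" using ab(4) assms(9) by simp
      show "odd (x + B * y)" "odd (x - A * y)" using x y by auto
      show "(x + B * y) * (x - A * y) mod 4 = r"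
        unfolding product_mod_4_odd_even[OF AB' x y] r_def ..
      have "- y div 2 = - (y div 2)" using y by (simp add: dvd_neg_div)
      hence "even (- y div 2) = even (y div 2)" by simp
      thus "(x - B * y) * (x + A * y) mod 4 = r"
        using product_mod_4_odd_even[OF AB' x, of "- y"] y unfolding r_def by simp
    qed (use ab in auto)
    thus ?thesis unfolding powi_minus_one r_def by simp
  qed
  show ?thesis using i ii sigma by blast
qed

end
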